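(* Let $n\ge1$, $1\le p<\infty$, $0\leq\gamma<1$, $1<q<\infty$, and let $w$ be a locally integrable weight on $\mathbb{R}^{n+1}$. Then there are constants $C_1 = C_1(n,p,\gamma)$ and $C_2=C_2(n,p,\gamma,q)$ such that $$w\bigl( \{ M_{c}^{\gamma+}f > \lambda \}\bigr) \leq \frac{C_1}{\lambda} \int_{\mathbb{R}^{n+1}} |f| \, M^{\gamma-}w\,dx\,dt$$ for every $\lambda>0$ and every $f\in L^1_{\mathrm{loc}}(\mathbb{R}^{n+1})$. Moreover, $$\int_{\mathbb{R}^{n+1}} (M_c^{\gamma+}f)^q \, w \,dx\,dt \leq C_2 \int_{\mathbb{R}^{n+1}} |f|^q \, M^{\gamma-}w\,dx\,dt$$ for every $f\in L^1_{\mathrm{loc}}(\mathbb{R}^{n+1})$.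
   Context: Write points of $\mathbb{R}^{n+1}$ as $(x,t)$ with $x\in\mathbb{R}^n$, $t\in\mathbb{R}$; $|A|$ is the Lebesgue measure of $A\subset\mathbb{R}^{n+1}$. The parameter $1\le p<\infty$ is fixed. For $x\in\mathbb{R}^n$ and $L>0$, let $Q(x,L)=\{y\in\mathbb{R}^n: |y_i-x_i|\le L/2,\ i=1,\dots,n\}$. A parabolic rectangle centered at $(x,t)$ with sidelength $L>0$ is $R=R(x,t,L,p)=Q(x,L)\times(t-L^p,t+L^p)$. For $0\le\gamma<1$ (the time lag), its upper and lower parts are $$R^+(\gamma)=Q(x,L)\times(t+\gamma L^p,t+L^p),\qquad R^-(\gamma)=Q(x,L)\times(t-L^p,t-\gamma L^p),$$ and $z(R^{\pm}(\gamma))$ denotes the center point of $R^{\pm}(\gamma)$. A weight is a nonnegative measurable function on $\mathbb{R}^{n+1}$; for a weight $w$ and a measurable set $A$, $w(A)=\int_A w\,dx\,dt$. For a locally integrable $f$, the centered forward in time parabolic maximal function and the uncentered backward in time parabolic maximal function are $$M^{\gamma+}_{c} f(x,t)=\sup_{z(R^-(\gamma))=(x,t)} \frac{1}{|R^+(\gamma)|}\int_{R^+(\gamma)}|f|,\qquad M^{\gamma-} f(x,t)=\sup_{R^+(\gamma)\ni(x,t)} \frac{1}{|R^-(\gamma)|}\int_{R^-(\gamma)}|f|,$$ the suprema being over all parabolic rectangles $R\subset\mathbb{R}^{n+1}$ such that $(x,t)$ is the center point of $R^-(\gamma)$, respectively such that $(x,t)\in R^+(\gamma)$. *)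

theory Defs
  imports "HOL-Analysis.Analysis"
begin

text \<open>
  Space-time \<open>\<real>\<^sup>n \<times> \<real>\<close> is the Euclidean space \<open>(real ^ 'n) \<times> real\<close> with \<open>n = CARD('n)\<close>.
  Maximal functions, averages and integrals of nonnegative functions are \<open>ennreal\<close>-valued, so
  each of them may be \<open>\<infinity>\<close>, and \<open>0 * \<infinity> = 0\<close>.
\<close>

type_synonym 'n spacetime = "(real ^ 'n) \<times> real"

definition cube :: "real ^ 'n \<Rightarrow> real \<Rightarrow> (real ^ 'n) set" where
  "cube x L = {y. \<forall>i. \<bar>y $ i - x $ i\<bar> \<le> L / 2}"

text \<open>
  A parabolic rectangle \<open>R(x,t,L,p)\<close> is represented by its parameters, with \<open>L > 0\<close> required
  where it is quantified over.
\<close>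

definition upper_part :: "real \<Rightarrow> real \<Rightarrow> real ^ 'n \<Rightarrow> real \<Rightarrow> real \<Rightarrow> 'n::finite spacetime set" where
  "upper_part p \<gamma> x t L = cube x L \<times> {t + \<gamma> * L powr p <..< t + L powr p}"

definition lower_part :: "real \<Rightarrow> real \<Rightarrow> real ^ 'n \<Rightarrow> real \<Rightarrow> real \<Rightarrow> 'n::finite spacetime set" where
  "lower_part p \<gamma> x t L = cube x L \<times> {t - L powr p <..< t - \<gamma> * L powr p}"

definition lower_center :: "real \<Rightarrow> real \<Rightarrow> real ^ 'n \<Rightarrow> real \<Rightarrow> real \<Rightarrow> 'n::finite spacetime" where
  "lower_center p \<gamma> x t L = (x, midpoint (t - L powr p) (t - \<gamma> * L powr p))"

definition average_abs :: "('n::finite spacetime \<Rightarrow> real) \<Rightarrow> 'n spacetime set \<Rightarrow> ennreal" where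
  "average_abs f A = (\<integral>\<^sup>+z\<in>A. ennreal \<bar>f z\<bar> \<partial>lebesgue) / emeasure lebesgue A"

definition centered_forward_max ::
    "real \<Rightarrow> real \<Rightarrow> ('n::finite spacetime \<Rightarrow> real) \<Rightarrow> 'n spacetime \<Rightarrow> ennreal" where
  "centered_forward_max p \<gamma> f z =
     (SUP (x, t, L) \<in> {(x, t, L). 0 < L \<and> lower_center p \<gamma> x t L = z}.
        average_abs f (upper_part p \<gamma> x t L))"

definition uncentered_backward_max ::
    "real \<Rightarrow> real \<Rightarrow> ('n::finite spacetime \<Rightarrow> real) \<Rightarrow> 'n spacetime \<Rightarrow> ennreal" where
  "uncentered_backward_max p \<gamma> f z =
     (SUP (x, t, L) \<in> {(x, t, L). 0 < L \<and> z \<in> upper_part p \<gamma> x t L}.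
        average_abs f (lower_part p \<gamma> x t L))"

text \<open>
  Absolute integrability on every compact set; since the space is \<open>\<sigma>\<close>-compact this includes
  Lebesgue measurability.
\<close>

definition locally_integrable :: "('a::euclidean_space \<Rightarrow> real) \<Rightarrow> bool" where
  "locally_integrable f \<longleftrightarrow> (\<forall>K. compact K \<longrightarrow> f absolutely_integrable_on K)"

definition weight :: "('a::euclidean_space \<Rightarrow> real) \<Rightarrow> bool" where
  "weight w \<longleftrightarrow> w \<in> borel_measurable lebesgue \<and> (\<forall>z. 0 \<le> w z)"

definition weighted_measure :: "('a::euclidean_space \<Rightarrow> real) \<Rightarrow> 'a set \<Rightarrow> ennreal" where
  "weighted_measure w A = (\<integral>\<^sup>+z\<in>A. ennreal (w z) \<partial>lebesgue)"

text \<open>Real powers on \<open>[0,\<infinity>]\<close>, for exponents \<open>q > 0\<close>.\<close>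

definition ennreal_powr :: "ennreal \<Rightarrow> real \<Rightarrow> ennreal" where
  "ennreal_powr a q = (if a = \<infinity> then \<infinity> else ennreal (enn2real a powr q))"

end

theory Submission
  imports Defs
begin

text \<open>
  For integrable \<open>f\<close> the average of \<open>\<bar>f\<bar>\<close> over \<open>R\<^sup>+\<close> depends continuously on the sidelength and tends
  to \<open>0\<close>, so every point of \<open>{M f > \<lambda>}\<close> is the center of some \<open>R\<^sup>-\<close> for which the average over \<open>R\<^sup>+\<close> is
  exactly \<open>\<lambda>\<close>. By Lindelof and a finite Vitali selection it suffices to treat finitely many such
  rectangles \<open>R\<^sub>j\<close> for which the concentric third parts of the \<open>R\<^sub>j\<^sup>-\<close> are disjoint, the \<open>R\<^sub>j\<^sup>-\<close>
  still covering. The sets \<open>R\<^sub>j\<^sup>+\<close> may overlap without bound, but volume packing gives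
  \<open>\<Sum> \<bar>R\<^sub>k\<^sup>+\<bar> \<le> C \<bar>R\<^sub>j\<^sup>+\<bar>\<close> over all \<open>k\<close> that are not larger than \<open>j\<close> and meet \<open>R\<^sub>j\<^sup>+\<close>.
  Since the measure \<open>\<nu> = \<bar>f\<bar> dz\<close> is exactly \<open>\<lambda>\<close> times volume on each \<open>R\<^sub>j\<^sup>+\<close>, the same packing
  holds for \<open>\<nu>\<close>. By Markov's inequality, half of the \<open>\<nu>\<close>-mass of \<open>R\<^sub>j\<^sup>+\<close> lies in
  the set \<open>F\<^sub>j\<close> of points contained in at most \<open>2 C\<close> of the smaller \<open>R\<^sub>k\<^sup>+\<close>, and the \<open>F\<^sub>j\<close> have overlap at
  most \<open>2 C\<close>. As \<open>w(R\<^sub>j\<^sup>-) / \<bar>R\<^sub>j\<^sup>-\<bar>\<close> is at most the backward maximal function of \<open>w\<close> on \<open>F\<^sub>j\<close>,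
  summing over \<open>j\<close> gives the weak type bound. The strong type bound follows by splitting \<open>f\<close> at height
  \<open>2\<^sup>k\<close> for every integer \<open>k\<close>, a discrete form of Marcinkiewicz interpolation.
\<close>

text \<open>As a simp rule it would turn \<open>emeasure lebesgue\<close> into \<open>emeasure lborel\<close>.\<close>
declare emeasure_completion [simp del]

subsection \<open>Averages over space-time rectangles\<close>

lemma cube_eq_cbox: "cube x L = cbox (\<chi> i. x $ i - L / 2) (\<chi> i. x $ i + L / 2)"
proof (rule set_eqI)
  fix y
  have "\<bar>y $ i - x $ i\<bar> \<le> L / 2 \<longleftrightarrow> x $ i - L / 2 \<le> y $ i \<and> y $ i \<le> x $ i + L / 2" for i
    by linarith
  then show "y \<in> cube x L \<longleftrightarrow> y \<in> cbox (\<chi> i. x $ i - L / 2) (\<chi> i. x $ i + L / 2)"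
    by (simp add: cube_def mem_box_cart)
qed

lemma sets_cube [measurable]: "cube x L \<in> sets borel"
  by (simp add: cube_eq_cbox)

lemma emeasure_cube:
  fixes x :: "real ^ 'n::finite"
  assumes "0 \<le> L"
  shows "emeasure lborel (cube x L) = ennreal (L ^ CARD('n))"
proof -
  have "cbox (\<chi> i. x $ i - L / 2) (\<chi> i. x $ i + L / 2) \<noteq> {}"
    using assms by (auto simp: interval_ne_empty_cart)
  then have "measure lborel (cbox (\<chi> i. x $ i - L / 2) (\<chi> i. x $ i + L / 2)) = L ^ CARD('n)"
    by (simp add: content_cbox_cart)
  then show ?thesis
    unfolding cube_eq_cbox by (metis emeasure_eq_ennreal_measure emeasure_lborel_cbox_finite infinity_ennreal_def less_irrefl)
qed

lemma sets_rectangle [measurable]: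
  fixes x :: "real ^ 'n::finite" and a b :: real
  shows "cube x L \<times> {a<..<b} \<in> sets borel"
proof -
  have "cube x L \<times> {a<..<b} \<in> sets (borel \<Otimes>\<^sub>M borel)" by (auto simp: sets_cube)
  then show ?thesis by (subst (asm) borel_prod)
qed

lemma sets_lebesgue_rectangle [measurable, simp]:
  fixes x :: "real ^ 'n::finite" and a b :: real
  shows "cube x L \<times> {a<..<b} \<in> sets lebesgue"
  using sets_rectangle by (simp add: lborelD sets_completionI_sets)

lemma emeasure_rectangle:
  fixes x :: "real ^ 'n::finite" and a b :: real
  assumes "0 \<le> L" "a \<le> b"
  shows "emeasure lebesgue (cube x L \<times> {a<..<b}) = ennreal (L ^ CARD('n) * (b - a))"
proof -
  have "emeasure lebesgue (cube x L \<times> {a<..<b}) = emeasure lborel (cube x L \<times> {a<..<b})"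
    by (simp add: emeasure_completion sets_rectangle)
  also have "\<dots> = emeasure (lborel \<Otimes>\<^sub>M lborel) (cube x L \<times> {a<..<b})"
    by (simp add: lborel_prod)
  also have "\<dots> = ennreal (L ^ CARD('n)) * ennreal (b - a)"
    using assms
    by (subst lborel.emeasure_pair_measure_Times) (auto simp: emeasure_cube sets_cube)
  finally show ?thesis using assms by (simp add: ennreal_mult)
qed

lemma box_Pair_eq:
  fixes a b :: "real ^ 'n::finite" and c d :: real
  shows "box (a, c) (b, d) = box a b \<times> {c<..<d}"
  by (force simp: box_def Basis_prod_def inner_prod_def)

text \<open>Off the boundary of the limit box, \<open>z\<close> either satisfies all defining
  inequalities strictly or violates one strictly. Strict inequalities survive small changes of the
  parameters, so the indicators are eventually constant.\<close>

lemma tendsto_indicator_rectangle: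
  fixes x :: "real ^ 'n::finite" and z :: "'n::finite spacetime"
  assumes X: "X \<longlonglongrightarrow> x" and R: "R \<longlonglongrightarrow> r" and A: "A \<longlonglongrightarrow> a" and B: "B \<longlonglongrightarrow> b"
    and z: "z \<notin> cbox ((\<chi> i. x $ i - r / 2), a) ((\<chi> i. x $ i + r / 2), b)
            - box ((\<chi> i. x $ i - r / 2), a) ((\<chi> i. x $ i + r / 2), b)"
  shows "(\<lambda>k. indicator (cube (X k) (R k) \<times> {A k<..<B k}) z :: ennreal)
           \<longlonglongrightarrow> indicator (cube x r \<times> {a<..<b}) z"
proof (rule tendsto_eventually)
  obtain y u where zyu: "z = (y, u)" by (cases z)
  have lim: "(\<lambda>k. \<bar>y $ i - X k $ i\<bar> - R k / 2) \<longlonglongrightarrow> \<bar>y $ i - x $ i\<bar> - r / 2" for i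
    by (intro tendsto_intros X R) simp
  show "\<forall>\<^sub>F k in sequentially. (indicator (cube (X k) (R k) \<times> {A k<..<B k}) z :: ennreal)
          = indicator (cube x r \<times> {a<..<b}) z"
  proof (cases "z \<in> box ((\<chi> i. x $ i - r / 2), a) ((\<chi> i. x $ i + r / 2), b)")
    case True
    then have "x $ i - r / 2 < y $ i \<and> y $ i < x $ i + r / 2" "a < u" "u < b" for i
      by (simp_all add: zyu box_Pair_eq mem_box_cart)
    then have *: "\<bar>y $ i - x $ i\<bar> - r / 2 < 0" "a < u" "u < b" for i
      by (smt (verit))+
    have "\<forall>\<^sub>F k in sequentially. \<forall>i\<in>UNIV. \<bar>y $ i - X k $ i\<bar> - R k / 2 < 0"
      using order_tendstoD(2)[OF lim *(1)] by (intro eventually_ball_finite) auto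
    moreover have "\<forall>\<^sub>F k in sequentially. A k < u" "\<forall>\<^sub>F k in sequentially. u < B k"
      using order_tendstoD A B *(2,3) by blast+
    ultimately show ?thesis
    proof eventually_elim
      case (elim k)
      then show ?case using * by (force simp: zyu cube_def indicator_def less_imp_le)
    qed
  next
    case False
    then have "z \<notin> cbox ((\<chi> i. x $ i - r / 2), a) ((\<chi> i. x $ i + r / 2), b)" using z by auto
    then have out: "y \<notin> cube x r \<or> u < a \<or> b < u"
      by (auto simp: zyu cbox_Pair_eq cube_eq_cbox)
    then consider i where "0 < \<bar>y $ i - x $ i\<bar> - r / 2" | "u < a" | "b < u"
      by (auto simp: cube_def not_le)
    then have "\<forall>\<^sub>F k in sequentially. z \<notin> cube (X k) (R k) \<times> {A k<..<B k}"
    proof cases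
      case 1
      then show ?thesis using order_tendstoD(1)[OF lim 1]
        by (auto elim!: eventually_mono simp: zyu cube_def not_le)
    next
      case 2
      then show ?thesis using order_tendstoD(1)[OF A 2]
        by (auto elim!: eventually_mono simp: zyu)
    next
      case 3
      then show ?thesis using order_tendstoD(2)[OF B 3]
        by (auto elim!: eventually_mono simp: zyu)
    qed
    moreover have "z \<notin> cube x r \<times> {a<..<b}" using out by (auto simp: zyu)
    ultimately show ?thesis by (auto elim!: eventually_mono)
  qed
qed

text \<open>Dominated convergence with majorant |f|: the boundary of the limit box is a null set,
  and the volumes tend to a positive limit. All parameters move at once, which gives continuity in
  the center as well as in the sidelength.\<close>

lemma tendsto_average_abs:
  fixes f :: "'n::finite spacetime \<Rightarrow> real"
  assumes f: "integrable lebesgue f"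
    and X: "X \<longlonglongrightarrow> x" and R: "R \<longlonglongrightarrow> r" and A: "A \<longlonglongrightarrow> a" and B: "B \<longlonglongrightarrow> b"
    and "0 < r" "a < b"
  shows "(\<lambda>k. average_abs f (cube (X k) (R k) \<times> {A k<..<B k}))
           \<longlonglongrightarrow> average_abs f (cube x r \<times> {a<..<b})"
proof -
  define I where "I S = (\<integral>\<^sup>+z\<in>S. ennreal \<bar>f z\<bar> \<partial>lebesgue)" for S
  have fin: "(\<integral>\<^sup>+z. ennreal \<bar>f z\<bar> \<partial>lebesgue) < \<infinity>"
    using f by (simp add: integrable_iff_bounded)
  have I_fin: "I S < \<infinity>" for S
    unfolding I_def by (rule le_less_trans[OF nn_integral_mono fin]) (auto simp: indicator_def)
  have fm [measurable]: "f \<in> borel_measurable lebesgue" using f by auto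
  have lim_I: "(\<lambda>k. I (cube (X k) (R k) \<times> {A k<..<B k})) \<longlonglongrightarrow> I (cube x r \<times> {a<..<b})"
    unfolding I_def
  proof (rule nn_integral_dominated_convergence[OF _ _ _ _ fin])
    have "AE z in lebesgue. z \<notin> cbox ((\<chi> i. x $ i - r / 2), a) ((\<chi> i. x $ i + r / 2), b)
            - box ((\<chi> i. x $ i - r / 2), a) ((\<chi> i. x $ i + r / 2), b)"
      using negligible_frontier_interval by (intro AE_not_in) (simp add: negligible_iff_null_sets)
    then show "AE z in lebesgue. (\<lambda>k. ennreal \<bar>f z\<bar> * indicator (cube (X k) (R k) \<times> {A k<..<B k}) z)
       \<longlonglongrightarrow> ennreal \<bar>f z\<bar> * indicator (cube x r \<times> {a<..<b}) z"
      by eventually_elim (intro ennreal_tendsto_cmult tendsto_indicator_rectangle X R A B; simp)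
  next
    show "(\<lambda>z. ennreal \<bar>f z\<bar> * indicator (cube (X k) (R k) \<times> {A k<..<B k}) z)
      \<in> borel_measurable lebesgue" for k
      by measurable
    show "(\<lambda>z. ennreal \<bar>f z\<bar> * indicator (cube x r \<times> {a<..<b}) z) \<in> borel_measurable lebesgue"
      by measurable
  qed (auto simp: indicator_def)
  have avg: "average_abs f (cube x r \<times> {a<..<b})
      = ennreal (enn2real (I (cube x r \<times> {a<..<b})) / (r ^ CARD('n) * (b - a)))"
    if "0 < r" "a < b" for x r a b
    using that I_fin[of "cube x r \<times> {a<..<b}"]
    unfolding average_abs_def I_def[symmetric]
    by (subst emeasure_rectangle) (simp_all flip: divide_ennreal)
  have "\<forall>\<^sub>F k in sequentially. 0 < R k \<and> 0 < B k - A k"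
    using \<open>0 < r\<close> \<open>a < b\<close>
    by (intro eventually_conj order_tendstoD(1)[OF R] order_tendstoD(1)[OF tendsto_diff[OF B A]]) auto
  then have ev: "\<forall>\<^sub>F k in sequentially. average_abs f (cube (X k) (R k) \<times> {A k<..<B k}) =
     ennreal (enn2real (I (cube (X k) (R k) \<times> {A k<..<B k})) / (R k ^ CARD('n) * (B k - A k)))"
    by eventually_elim (simp add: avg)
  have "(\<lambda>k. enn2real (I (cube (X k) (R k) \<times> {A k<..<B k}))) \<longlonglongrightarrow> enn2real (I (cube x r \<times> {a<..<b}))"
    using lim_I I_fin[of "cube x r \<times> {a<..<b}"] by (intro tendsto_enn2real) auto
  then have "(\<lambda>k. ennreal (enn2real (I (cube (X k) (R k) \<times> {A k<..<B k})) / (R k ^ CARD('n) * (B k - A k))))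
     \<longlonglongrightarrow> ennreal (enn2real (I (cube x r \<times> {a<..<b})) / (r ^ CARD('n) * (b - a)))"
    using \<open>0 < r\<close> \<open>a < b\<close> by (intro tendsto_ennrealI tendsto_divide tendsto_mult tendsto_power tendsto_diff R A B) auto
  then show ?thesis using ev avg[OF \<open>0 < r\<close> \<open>a < b\<close>] by (simp add: filterlim_cong)
qed

subsection \<open>Truncation and lower semicontinuity of the maximal functions\<close>

text \<open>Cuts down the support and not the values: a locally integrable function becomes
  integrable, and the absolute values increase with \<open>k\<close>.\<close>

definition truncation :: "nat \<Rightarrow> ('a::euclidean_space \<Rightarrow> real) \<Rightarrow> 'a \<Rightarrow> real" where
  "truncation k f z = indicator (cball 0 (real k)) z * f z"

lemma integrable_truncation: "locally_integrable f \<Longrightarrow> integrable lebesgue (truncation k f)"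
  by (simp add: locally_integrable_def set_integrable_def truncation_def[abs_def])

lemma eventually_truncation: "\<forall>\<^sub>F k in sequentially. truncation k f z = f z"
proof -
  obtain N :: nat where "norm z \<le> real N" using real_arch_simple by blast
  then have "truncation k f z = f z" if "N \<le> k" for k
    using that by (simp add: truncation_def)
  then show ?thesis using eventually_sequentially by blast
qed

lemma locally_integrable_measurable:
  assumes "locally_integrable f"
  shows "f \<in> borel_measurable lebesgue"
proof (rule borel_measurable_LIMSEQ_real)
  show "(\<lambda>k. truncation k f z) \<longlonglongrightarrow> f z" for z
    by (rule tendsto_eventually[OF eventually_truncation])
  show "truncation k f \<in> borel_measurable lebesgue" for k
    using integrable_truncation[OF assms] by auto
qed

lemma locally_integrable_bound:
  assumes "locally_integrable f" "g \<in> borel_measurable lebesgue" "\<And>z. \<bar>g z\<bar> \<le> \<bar>f z\<bar>"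
  shows "locally_integrable g"
  unfolding locally_integrable_def set_integrable_def
proof safe
  fix K :: "'a set" assume K: "compact K"
  then have [measurable]: "K \<in> sets lebesgue" by (simp add: lmeasurable_compact fmeasurableD)
  have [measurable]: "g \<in> borel_measurable lebesgue" by fact
  have "integrable lebesgue (\<lambda>z. indicator K z *\<^sub>R f z)"
    using assms(1) K by (simp add: locally_integrable_def set_integrable_def)
  then show "integrable lebesgue (\<lambda>z. indicator K z *\<^sub>R g z)"
    by (rule Bochner_Integration.integrable_bound) (use assms(3) in \<open>auto simp: indicator_def\<close>)
qed

lemma mono_truncation: "mono (\<lambda>k. ennreal \<bar>truncation k f z\<bar>)"
  by (rule monoI) (auto simp: truncation_def indicator_def)

lemma SUP_truncation: "(SUP k. ennreal \<bar>truncation k f z\<bar>) = ennreal \<bar>f z\<bar>"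
proof (rule LIMSEQ_unique[OF LIMSEQ_SUP[OF mono_truncation]])
  show "(\<lambda>k. ennreal \<bar>truncation k f z\<bar>) \<longlonglongrightarrow> ennreal \<bar>f z\<bar>"
    by (rule tendsto_eventually) (use eventually_truncation[of f z] in eventually_elim, simp)
qed

lemma average_abs_mono:
  "(\<And>z. \<bar>f z\<bar> \<le> \<bar>g z\<bar>) \<Longrightarrow> average_abs f A \<le> average_abs g A"
  unfolding average_abs_def
  by (intro divide_right_mono_ennreal nn_integral_mono mult_right_mono ennreal_leI) auto

lemma average_abs_truncation:
  assumes f: "locally_integrable f" and [measurable]: "A \<in> sets lebesgue"
  shows "average_abs f A = (SUP k. average_abs (truncation k f) A)"
proof -
  have [measurable]: "truncation k f \<in> borel_measurable lebesgue" for k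
    using integrable_truncation[OF f] by auto
  have "(\<integral>\<^sup>+z\<in>A. ennreal \<bar>f z\<bar> \<partial>lebesgue)
      = (\<integral>\<^sup>+z. (SUP k. ennreal \<bar>truncation k f z\<bar> * indicator A z) \<partial>lebesgue)"
    by (intro nn_integral_cong) (simp add: SUP_truncation flip: SUP_mult_right_ennreal)
  also have "\<dots> = (SUP k. \<integral>\<^sup>+z\<in>A. ennreal \<bar>truncation k f z\<bar> \<partial>lebesgue)"
  proof (rule nn_integral_monotone_convergence_SUP)
    show "incseq (\<lambda>k z. ennreal \<bar>truncation k f z\<bar> * indicator A z)"
      using mono_truncation[of f] by (auto simp: mono_def le_fun_def intro!: mult_right_mono)
  qed measurable
  finally show ?thesis by (simp add: average_abs_def SUP_divide_ennreal)
qed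

section \<open>Superlevel sets of the maximal functions\<close>

lemma sets_lebesgue_parts [simp]:
  "upper_part p \<gamma> x t L \<in> sets lebesgue" "lower_part p \<gamma> x t L \<in> sets lebesgue"
  by (simp_all add: upper_part_def lower_part_def)

text \<open>Prescribing the center of the lower part determines \<open>x\<close> and
  \<open>t\<close> in terms of \<open>L\<close>, so the sidelength is the only free parameter of the
  supremum.\<close>

lemma centered_forward_max_eq:
  "centered_forward_max p \<gamma> f (x, s) =
     (SUP L\<in>{0<..}. average_abs f (upper_part p \<gamma> x (s + (1 + \<gamma>) / 2 * L powr p) L))"
proof -
  have "{(x', t, L). 0 < L \<and> lower_center p \<gamma> x' t L = (x, s)}
      = (\<lambda>L. (x, s + (1 + \<gamma>) / 2 * L powr p, L)) ` {0<..}"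
    by (auto simp: lower_center_def midpoint_def image_iff field_simps)
  then show ?thesis by (simp add: centered_forward_max_def image_comp o_def)
qed

lemma average_abs_le_uncentered_backward_max:
  assumes "0 < L" "z \<in> upper_part p \<gamma> x t L"
  shows "average_abs f (lower_part p \<gamma> x t L) \<le> uncentered_backward_max p \<gamma> f z"
  unfolding uncentered_backward_max_def
  by (rule SUP_upper2[of "(x, t, L)"]) (use assms in auto)

lemma centered_forward_max_truncation:
  assumes "locally_integrable f"
  shows "centered_forward_max p \<gamma> f z = (SUP k. centered_forward_max p \<gamma> (truncation k f) z)"
  by (cases z) (simp add: centered_forward_max_eq average_abs_truncation[OF assms], rule SUP_commute)

lemma uncentered_backward_max_truncation:
  assumes "locally_integrable f"
  shows "uncentered_backward_max p \<gamma> f z = (SUP k. uncentered_backward_max p \<gamma> (truncation k f) z)"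
  unfolding uncentered_backward_max_def case_prod_beta
  by (simp add: average_abs_truncation[OF assms], rule SUP_commute)

text \<open>For each fixed sidelength the average is continuous in the center, and a supremum of
  continuous functions is lower semicontinuous.\<close>

lemma open_superlevel_integrable_centered_forward_max:
  assumes f: "integrable lebesgue f" and "\<gamma> < 1"
  shows "open {z. c < centered_forward_max p \<gamma> f z}"
proof -
  have "continuous_on UNIV
      (\<lambda>z. average_abs f (upper_part p \<gamma> (fst z) (snd z + (1 + \<gamma>) / 2 * L powr p) L))" if "0 < L" for L
    unfolding upper_part_def
    by (intro continuous_on_sequentiallyI tendsto_average_abs f tendsto_intros that) (use assms(2) that in auto)
  then have "open {z. c < average_abs f (upper_part p \<gamma> (fst z) (snd z + (1 + \<gamma>) / 2 * L powr p) L)}"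
    if "0 < L" for L
    using that by (intro open_Collect_less continuous_on_const) auto
  then have "open (\<Union>L\<in>{0<..}. {z. c < average_abs f (upper_part p \<gamma> (fst z) (snd z + (1 + \<gamma>) / 2 * L powr p) L)})"
    by auto
  also have "(\<Union>L\<in>{0<..}. {z. c < average_abs f (upper_part p \<gamma> (fst z) (snd z + (1 + \<gamma>) / 2 * L powr p) L)})
      = {z. c < centered_forward_max p \<gamma> f z}"
    by (auto simp: centered_forward_max_eq less_SUP_iff)
  finally show ?thesis .
qed

lemma open_superlevel_centered_forward_max:
  assumes f: "locally_integrable f" and "\<gamma> < 1"
  shows "open {z. c < centered_forward_max p \<gamma> f z}"
proof -
  have "{z. c < centered_forward_max p \<gamma> f z}
      = (\<Union>k. {z. c < centered_forward_max p \<gamma> (truncation k f) z})"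
    by (auto simp: centered_forward_max_truncation[OF f] less_SUP_iff)
  then show ?thesis
    using open_superlevel_integrable_centered_forward_max[OF integrable_truncation[OF f] assms(2)] by auto
qed

text \<open>Cubes are closed, so a point of the upper part may lie on its lateral boundary. A slight
  enlargement of the sidelength moves the point inside and, by continuity, keeps the average above
  \<open>c\<close>. The enlarged rectangle then serves a whole neighborhood of the point.\<close>

lemma open_superlevel_integrable_uncentered_backward_max:
  fixes f :: "'n::finite spacetime \<Rightarrow> real"
  assumes f: "integrable lebesgue f" and "\<gamma> < 1"
  shows "open {z. c < uncentered_backward_max p \<gamma> f z}"
proof (subst open_subopen, clarsimp simp del: fst_conv)
  fix y :: "real ^ 'n" and u
  assume "c < uncentered_backward_max p \<gamma> f (y, u)"
  then obtain x t L where "0 < L" and z: "(y, u) \<in> upper_part p \<gamma> x t L"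
    and c: "c < average_abs f (lower_part p \<gamma> x t L)"
    by (auto simp: uncentered_backward_max_def less_SUP_iff)
  define l where "l k = L + inverse (real (Suc k))" for k
  have l: "l \<longlonglongrightarrow> L"
    unfolding l_def using tendsto_add[OF tendsto_const LIMSEQ_inverse_real_of_nat, of L] by simp
  have lp: "(\<lambda>k. l k powr p) \<longlonglongrightarrow> L powr p"
    using \<open>0 < L\<close> by (intro tendsto_intros l) auto
  have "(\<lambda>k. average_abs f (lower_part p \<gamma> x t (l k))) \<longlonglongrightarrow> average_abs f (lower_part p \<gamma> x t L)"
    unfolding lower_part_def
    by (intro tendsto_average_abs f tendsto_intros l lp) (use \<open>0 < L\<close> \<open>\<gamma> < 1\<close> in auto)
  then have "\<forall>\<^sub>F k in sequentially. c < average_abs f (lower_part p \<gamma> x t (l k))"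
    using c by (rule order_tendstoD)
  \<comment> \<open>For \<gamma> > 0 the enlargement also raises the lower end of the time interval;
    the strict inequality at \<open>L\<close> leaves room for this.\<close>
  moreover have "\<forall>\<^sub>F k in sequentially. t + \<gamma> * l k powr p < u"
    by (rule order_tendstoD(2)[of _ "t + \<gamma> * L powr p"])
       (use z in \<open>auto intro!: tendsto_intros lp simp: upper_part_def\<close>)
  moreover have "\<forall>\<^sub>F k in sequentially. u < t + l k powr p"
    by (rule order_tendstoD(1)[of _ "t + L powr p"])
       (use z in \<open>auto intro!: tendsto_intros lp simp: upper_part_def\<close>)
  ultimately have "\<forall>\<^sub>F k in sequentially. c < average_abs f (lower_part p \<gamma> x t (l k))
      \<and> t + \<gamma> * l k powr p < u \<and> u < t + l k powr p"
    by eventually_elim simp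
  then obtain k where k: "c < average_abs f (lower_part p \<gamma> x t (l k))"
      "t + \<gamma> * l k powr p < u" "u < t + l k powr p"
    using eventually_happens'[OF sequentially_bot] by blast
  have "L < l k" by (simp add: l_def)
  define T where "T = box (\<chi> i. x $ i - l k / 2) (\<chi> i. x $ i + l k / 2) \<times> {t + \<gamma> * l k powr p<..<t + l k powr p}"
  have "T \<subseteq> upper_part p \<gamma> x t (l k)"
    unfolding T_def upper_part_def cube_eq_cbox using box_subset_cbox by fastforce
  then have "T \<subseteq> {z. c < uncentered_backward_max p \<gamma> f z}"
    using less_le_trans[OF k(1) average_abs_le_uncentered_backward_max] \<open>0 < L\<close> \<open>L < l k\<close> by fastforce
  moreover have "y \<in> box (\<chi> i. x $ i - l k / 2) (\<chi> i. x $ i + l k / 2)"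
  proof -
    have "x $ i - L / 2 \<le> y $ i \<and> y $ i \<le> x $ i + L / 2" for i
      using z by (simp add: upper_part_def cube_eq_cbox mem_box_cart)
    then have "x $ i - l k / 2 < y $ i \<and> y $ i < x $ i + l k / 2" for i
      using \<open>L < l k\<close> by (smt (verit) divide_strict_right_mono)
    then show ?thesis by (simp add: mem_box_cart)
  qed
  then have "(y, u) \<in> T" using k by (simp add: T_def)
  moreover have "open T" unfolding T_def by (intro open_Times open_box open_greaterThanLessThan)
  ultimately show "\<exists>T. open T \<and> (y, u) \<in> T \<and> T \<subseteq> {z. c < uncentered_backward_max p \<gamma> f z}"
    by blast
qed

lemma open_superlevel_uncentered_backward_max:
  assumes f: "locally_integrable f" and "\<gamma> < 1"
  shows "open {z. c < uncentered_backward_max p \<gamma> f z}"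
proof -
  have "{z. c < uncentered_backward_max p \<gamma> f z}
      = (\<Union>k. {z. c < uncentered_backward_max p \<gamma> (truncation k f) z})"
    by (auto simp: uncentered_backward_max_truncation[OF f] less_SUP_iff)
  then show ?thesis
    using open_superlevel_integrable_uncentered_backward_max[OF integrable_truncation[OF f] assms(2)] by auto
qed

lemma borel_measurable_uncentered_backward_max:
  assumes "locally_integrable f" and "\<gamma> < 1"
  shows "uncentered_backward_max p \<gamma> f \<in> borel_measurable lebesgue"
proof (rule borel_measurableI_greater)
  fix c
  have "{z \<in> space lebesgue. c < uncentered_backward_max p \<gamma> f z} \<in> sets borel"
    using open_superlevel_uncentered_backward_max[OF assms] by simp
  then show "{z \<in> space lebesgue. c < uncentered_backward_max p \<gamma> f z} \<in> sets lebesgue"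
    by (simp add: lborelD sets_completionI_sets)
qed

subsection \<open>Selection and packing\<close>

text \<open>Greedy choice: take an index of maximal size, discard every set that meets its set, and
  recurse on the rest. The geometry of the sets enters only when the lemma is applied.\<close>

lemma finite_Vitali_selection:
  fixes A :: "'i \<Rightarrow> 'b set" and L :: "'i \<Rightarrow> real"
  assumes "finite I" "\<And>i. i \<in> I \<Longrightarrow> A i \<noteq> {}"
  shows "\<exists>J\<subseteq>I. disjoint_family_on A J \<and> (\<forall>i\<in>I. \<exists>j\<in>J. A i \<inter> A j \<noteq> {} \<and> L i \<le> L j)"
  using assms
proof (induction I rule: finite_psubset_induct)
  case (psubset I)
  show ?case
  proof (cases "I = {}")
    case True
    then show ?thesis by (auto simp: disjoint_family_on_def)
  next
    case False
    then obtain m where m: "m \<in> I" "\<And>i. i \<in> I \<Longrightarrow> L i \<le> L m"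
      using obtains_MAX[OF psubset(1) False, of L] psubset(1)
      by (metis Max_ge finite_imageI imageI)
    define I' where "I' = {i \<in> I. A i \<inter> A m = {}}"
    have "m \<notin> I'" using psubset.prems m(1) by (auto simp: I'_def)
    then have "I' \<subset> I" using m(1) by (auto simp: I'_def)
    then obtain J where J: "J \<subseteq> I'" "disjoint_family_on A J"
      "\<And>i. i \<in> I' \<Longrightarrow> \<exists>j\<in>J. A i \<inter> A j \<noteq> {} \<and> L i \<le> L j"
      using psubset.IH[of I'] psubset.prems by (auto simp: I'_def)
    have "disjoint_family_on A (insert m J)"
      using J(1,2) by (fastforce simp: disjoint_family_on_def I'_def)
    moreover have "\<exists>j\<in>insert m J. A i \<inter> A j \<noteq> {} \<and> L i \<le> L j" if "i \<in> I" for i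
      using that J(3)[of i] m(2)[of i] by (cases "i \<in> I'") (auto simp: I'_def)
    ultimately show ?thesis
      using J(1) m(1) by (intro exI[of _ "insert m J"]) (auto simp: I'_def)
  qed
qed

text \<open>The sets \<open>B j\<close> may overlap without bound, so they are replaced by large
  subsets \<open>F j\<close> of bounded overlap. In the constant \<open>4 * C\<close>, a factor 2
  pays for the mass lost in this passage and \<open>2 * C\<close> for the remaining overlap.\<close>

lemma sum_le_nn_integral_of_packing:
  fixes L :: "'i \<Rightarrow> real" and a :: "'i \<Rightarrow> ennreal" and C :: real
  assumes fin: "finite J" and B [measurable]: "\<And>j. j \<in> J \<Longrightarrow> B j \<in> sets N"
    and [measurable]: "g \<in> borel_measurable N" and "0 < C"
    and B_fin: "\<And>j. j \<in> J \<Longrightarrow> emeasure N (B j) < \<infinity>"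
    and packing: "\<And>j. j \<in> J \<Longrightarrow>
        (\<Sum>k\<in>{k \<in> J. L k \<le> L j}. emeasure N (B k \<inter> B j)) \<le> ennreal C * emeasure N (B j)"
    and a: "\<And>j z. j \<in> J \<Longrightarrow> z \<in> B j \<Longrightarrow> a j \<le> g z"
  shows "(\<Sum>j\<in>J. a j * emeasure N (B j)) \<le> ennreal (4 * C) * (\<integral>\<^sup>+z. g z \<partial>N)"
proof -
  \<comment> \<open>The packing hypothesis bounds the mean of \<open>n j\<close> over
    \<open>B j\<close> by \<open>C\<close>. The threshold in \<open>F\<close> is twice this bound,
    so by Markov's inequality at least half of \<open>B j\<close> survives.\<close>
  define n :: "'i \<Rightarrow> 'a \<Rightarrow> ennreal" where "n j z = (\<Sum>k\<in>{k \<in> J. L k \<le> L j}. indicator (B k) z)" for j z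
  define F where "F j = B j \<inter> {z \<in> space N. n j z \<le> ennreal (2 * C)}" for j
  have n_meas [measurable]: "n j \<in> borel_measurable N" for j
    unfolding n_def[abs_def] by (intro borel_measurable_sum borel_measurable_indicator) auto
  have F [measurable]: "F j \<in> sets N" if "j \<in> J" for j
    unfolding F_def using that by measurable
  have half: "emeasure N (B j) \<le> 2 * emeasure N (F j)" if j: "j \<in> J" for j
  proof -
    have "ennreal (2 * C) * emeasure N (B j) = (\<integral>\<^sup>+z. ennreal (2 * C) * indicator (B j) z \<partial>N)"
      using j by (simp add: nn_integral_cmult)
    also have "\<dots> \<le> (\<integral>\<^sup>+z. ennreal (2 * C) * indicator (F j) z
        + (\<Sum>k\<in>{k \<in> J. L k \<le> L j}. indicator (B k \<inter> B j) z) \<partial>N)"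
    proof (rule nn_integral_mono)
      fix z assume "z \<in> space N"
      show "ennreal (2 * C) * indicator (B j) z \<le> ennreal (2 * C) * indicator (F j) z
        + (\<Sum>k\<in>{k \<in> J. L k \<le> L j}. indicator (B k \<inter> B j) z)"
      proof (cases "z \<in> B j - F j")
        case True
        then have "ennreal (2 * C) \<le> n j z" using \<open>z \<in> space N\<close> by (auto simp: F_def)
        then show ?thesis using True by (simp add: indicator_inter_arith n_def)
      qed (auto simp: indicator_def)
    qed
    also have "\<dots> = ennreal (2 * C) * emeasure N (F j)
        + (\<Sum>k\<in>{k \<in> J. L k \<le> L j}. emeasure N (B k \<inter> B j))"
    proof -
      have "(\<integral>\<^sup>+z. (\<Sum>k\<in>{k \<in> J. L k \<le> L j}. indicator (B k \<inter> B j) z) \<partial>N)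
          = (\<Sum>k\<in>{k \<in> J. L k \<le> L j}. emeasure N (B k \<inter> B j))"
        using j B by (subst nn_integral_sum) (auto intro!: sum.cong borel_measurable_indicator)
      moreover have "(\<integral>\<^sup>+z. ennreal (2 * C) * indicator (F j) z \<partial>N) = ennreal (2 * C) * emeasure N (F j)"
        using F[OF j] by (rule nn_integral_cmult_indicator)
      ultimately show ?thesis
        using j B F[OF j] by (subst nn_integral_add) (auto intro!: borel_measurable_sum borel_measurable_indicator)
    qed
    also have "\<dots> \<le> ennreal (2 * C) * emeasure N (F j) + ennreal C * emeasure N (B j)"
      by (intro add_left_mono packing j)
    finally have ineq: "ennreal (2 * C) * emeasure N (B j)
        \<le> ennreal (2 * C) * emeasure N (F j) + ennreal C * emeasure N (B j)" .
    have "emeasure N (F j) \<le> emeasure N (B j)"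
      using j by (intro emeasure_mono) (auto simp: F_def)
    \<comment> \<open>Passing to real numbers, possible since \<open>B j\<close> has finite measure,
      permits subtracting \<open>C * b\<close> from both sides.\<close>
    then obtain b c where "emeasure N (B j) = ennreal b" "emeasure N (F j) = ennreal c" "0 \<le> b" "0 \<le> c"
      using B_fin[OF j] by (metis ennreal_cases infinity_ennreal_def leD top.extremum_strict not_le)
    moreover from this have "2 * C * b \<le> 2 * C * c + C * b"
      using ineq \<open>0 < C\<close> by (simp flip: ennreal_mult ennreal_plus)
    then have "C * b \<le> C * (2 * c)" by simp
    then have "b \<le> 2 * c" using \<open>0 < C\<close> by simp
    ultimately show ?thesis
      by (metis ennreal_leI ennreal_mult ennreal_numeral zero_le_numeral)
  qed
  have overlap: "(\<Sum>j\<in>J. indicator (F j) z) \<le> ennreal (2 * C)" for z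
  proof (cases "{j \<in> J. z \<in> F j} = {}")
    case True
    then have "(\<Sum>j\<in>J. indicator (F j) z :: ennreal) = 0" by (auto simp: indicator_def)
    then show ?thesis by simp
  next
    case False
    have "finite {j \<in> J. z \<in> F j}" using fin by simp
    \<comment> \<open>With \<open>m\<close> the largest index whose \<open>F m\<close> contains
      \<open>z\<close>, every other such set is counted by \<open>n m z\<close>, and membership in
      \<open>F m\<close> bounds that count.\<close>
    then obtain m where m: "m \<in> J" "z \<in> F m" "\<And>j. j \<in> J \<Longrightarrow> z \<in> F j \<Longrightarrow> L j \<le> L m"
      using obtains_MAX[OF _ False, of L] by (smt (verit) Max_ge finite_imageI imageI mem_Collect_eq)
    have "(\<Sum>j\<in>J. indicator (F j) z :: ennreal) = (\<Sum>j\<in>{k \<in> J. L k \<le> L m}. indicator (F j) z)"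
      using fin m(3) by (intro sum.mono_neutral_right) (auto simp: indicator_def)
    also have "\<dots> \<le> n m z"
      unfolding n_def by (intro sum_mono) (auto simp: F_def indicator_def)
    also have "\<dots> \<le> ennreal (2 * C)" using m(2) by (simp add: F_def)
    finally show ?thesis .
  qed
  have "(\<Sum>j\<in>J. a j * emeasure N (B j)) \<le> (\<Sum>j\<in>J. a j * (2 * emeasure N (F j)))"
    by (intro sum_mono mult_left_mono half) auto
  also have "\<dots> = 2 * (\<Sum>j\<in>J. a j * emeasure N (F j))"
    by (simp add: sum_distrib_left ac_simps)
  also have "(\<Sum>j\<in>J. a j * emeasure N (F j)) = (\<integral>\<^sup>+z. (\<Sum>j\<in>J. a j * indicator (F j) z) \<partial>N)"
    by (subst nn_integral_sum) (auto simp: nn_integral_cmult_indicator)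
  also have "\<dots> \<le> (\<integral>\<^sup>+z. ennreal (2 * C) * g z \<partial>N)"
  proof (rule nn_integral_mono)
    fix z
    have "(\<Sum>j\<in>J. a j * indicator (F j) z) \<le> (\<Sum>j\<in>J. indicator (F j) z * g z)"
      using a by (intro sum_mono) (auto simp: F_def indicator_def)
    also have "\<dots> \<le> ennreal (2 * C) * g z"
      using mult_right_mono[OF overlap] by (simp add: sum_distrib_right)
    finally show "(\<Sum>j\<in>J. a j * indicator (F j) z) \<le> ennreal (2 * C) * g z" .
  qed
  also have "2 * \<dots> = ennreal (4 * C) * (\<integral>\<^sup>+z. g z \<partial>N)"
  proof -
    have "ennreal (4 * C) = 2 * ennreal (2 * C)"
      using \<open>0 < C\<close> ennreal_mult[of 2 "2 * C"] by simp
    then show ?thesis by (simp add: nn_integral_cmult mult.assoc)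
  qed
  finally show ?thesis by (simp add: mult_left_mono)
qed

text \<open>Lindelof leaves a countable subfamily with the same union, and continuity from below
  along its finite unions does the rest. A bound uniform over finite subfamilies is therefore
  enough.\<close>

lemma emeasure_Union_open_le:
  fixes F :: "'a::euclidean_space set set"
  assumes op: "\<And>S. S \<in> F \<Longrightarrow> open S" and sets: "sets borel \<subseteq> sets M"
    and le: "\<And>F'. finite F' \<Longrightarrow> F' \<subseteq> F \<Longrightarrow> emeasure M (\<Union>F') \<le> c"
  shows "emeasure M (\<Union>F) \<le> c"
proof -
  obtain G where G: "G \<subseteq> F" "countable G" "\<Union>G = \<Union>F"
    using Lindelof op by metis
  show ?thesis
  proof (cases "G = {}")
    case True
    then have "\<Union>F = {}" using G(3) by simp
    then show ?thesis by (simp only: emeasure_empty) simp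
  next
    case False
    define e where "e = from_nat_into G"
    have e: "range e = G" using False G(2) by (simp add: e_def range_from_nat_into)
    have "(\<Union>n. \<Union>(e ` {..n})) = \<Union>(range e)" by auto
    then have "emeasure M (\<Union>F) = emeasure M (\<Union>n. \<Union>(e ` {..n}))"
      using G(3) e by simp
    also have "\<dots> = (SUP n. emeasure M (\<Union>(e ` {..n})))"
    proof (rule SUP_emeasure_incseq[symmetric])
      have "\<Union>(e ` {..n}) \<in> sets borel" for n
        using e G(1) op by (intro borel_open open_Union) auto
      then show "range (\<lambda>n. \<Union>(e ` {..n})) \<subseteq> sets M" using sets by auto
      show "incseq (\<lambda>n. \<Union>(e ` {..n}))" by (force simp: incseq_def)
    qed
    also have "\<dots> \<le> c" using e G(1) by (intro SUP_least le) auto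
    finally show ?thesis .
  qed
qed

subsection \<open>Weak type estimate\<close>

text \<open>The part of the lower rectangle concentric with it and a third of its size in each direction.\<close>
definition core :: "real \<Rightarrow> real \<Rightarrow> real ^ 'n \<Rightarrow> real \<Rightarrow> real \<Rightarrow> 'n::finite spacetime set" where
  "core p \<gamma> x t L = cube x (L / 3) \<times>
     {t - (1 + \<gamma>) / 2 * L powr p - (1 - \<gamma>) / 6 * L powr p <..<
      t - (1 + \<gamma>) / 2 * L powr p + (1 - \<gamma>) / 6 * L powr p}"

section \<open>Volumes and inclusions of cores, lower parts and upper parts\<close>

lemma emeasure_upper_part:
  assumes "0 < L" "\<gamma> < 1"
  shows "emeasure lebesgue (upper_part p \<gamma> (x :: real ^ 'n::finite) t L)
    = ennreal (L ^ CARD('n) * ((1 - \<gamma>) * L powr p))"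
  unfolding upper_part_def using assms by (subst emeasure_rectangle) (auto simp: algebra_simps)

lemma emeasure_lower_part:
  assumes "0 < L" "\<gamma> < 1"
  shows "emeasure lebesgue (lower_part p \<gamma> (x :: real ^ 'n::finite) t L)
    = emeasure lebesgue (upper_part p \<gamma> x t L)"
  unfolding upper_part_def lower_part_def using assms
  by (subst (1 2) emeasure_rectangle) (auto simp: algebra_simps)

text \<open>One factor 3 for each of the n space directions and one for time.\<close>

lemma emeasure_upper_part_eq_core:
  assumes "0 < L" "\<gamma> < 1"
  shows "emeasure lebesgue (upper_part p \<gamma> (x :: real ^ 'n::finite) t L)
    = ennreal (3 ^ Suc CARD('n)) * emeasure lebesgue (core p \<gamma> x t L)"
proof -
  have "emeasure lebesgue (core p \<gamma> x t L) = ennreal ((L / 3) ^ CARD('n) * ((1 - \<gamma>) / 3 * L powr p))"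
    unfolding core_def using assms by (subst emeasure_rectangle) (auto simp: field_simps)
  then show ?thesis
    using assms by (simp add: emeasure_upper_part field_simps power_divide flip: ennreal_mult)
qed

lemma sets_lebesgue_core [simp]: "core p \<gamma> x t L \<in> sets lebesgue"
  by (simp add: core_def)

text \<open>Lets the interiors of the cores serve as an open cover of a superlevel set.\<close>

lemma center_in_interior_core:
  fixes x :: "real ^ 'n::finite"
  assumes "0 < L" "\<gamma> < 1"
  shows "lower_center p \<gamma> x t L \<in> interior (core p \<gamma> x t L)"
proof -
  have "t - (1 + \<gamma>) / 2 * L powr p = midpoint (t - L powr p) (t - \<gamma> * L powr p)"
    by (simp add: midpoint_def field_simps)
  moreover have "0 < (1 - \<gamma>) / 6 * L powr p" using assms by simp
  ultimately show ?thesis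
    unfolding core_def lower_center_def cube_eq_cbox interior_Times interior_cbox
    using assms by (simp add: mem_box_cart)
qed

text \<open>The covering half of the Vitali argument: a core that meets a core at least as large
  lies in the threefold dilation of the latter, which is the lower part up to boundary
  points.\<close>

lemma core_subset_lower_part:
  fixes x y :: "real ^ 'n::finite"
  assumes "0 < l" "l \<le> L" "0 \<le> p" "\<gamma> < 1" and meet: "core p \<gamma> y s l \<inter> core p \<gamma> x t L \<noteq> {}"
  shows "core p \<gamma> y s l \<subseteq> lower_part p \<gamma> x t L"
proof
  fix z assume z: "z \<in> core p \<gamma> y s l"
  obtain m where m: "m \<in> core p \<gamma> y s l" "m \<in> core p \<gamma> x t L" using meet by blast
  have "\<bar>fst z $ i - x $ i\<bar> \<le> L / 2" for i
  proof -
    have "\<bar>fst z $ i - y $ i\<bar> \<le> l / 3 / 2" "\<bar>fst m $ i - y $ i\<bar> \<le> l / 3 / 2" "\<bar>fst m $ i - x $ i\<bar> \<le> L / 3 / 2"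
      using z m by (simp_all add: cube_def core_def mem_Times_iff)
    then show ?thesis using \<open>l \<le> L\<close> by linarith
  qed
  \<comment> \<open>\<open>h\<close> is half the height of the larger core. The way in time from
    \<open>z\<close> to the center of the small core, on to \<open>m\<close>, and on to the center
    of the large core has three pieces shorter than \<open>h\<close>.\<close>
  moreover define h where "h = (1 - \<gamma>) / 6 * L powr p"
  have "l powr p \<le> L powr p" using assms by (intro powr_mono2) auto
  then have "(1 - \<gamma>) / 6 * l powr p \<le> h" using assms unfolding h_def by (intro mult_left_mono) auto
  then have "t - (1 + \<gamma>) / 2 * L powr p - 3 * h < snd z \<and> snd z < t - (1 + \<gamma>) / 2 * L powr p + 3 * h"
    using z m by (auto simp: core_def mem_Times_iff h_def)
  moreover have "t - (1 + \<gamma>) / 2 * L powr p - 3 * h = t - L powr p"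
      "t - (1 + \<gamma>) / 2 * L powr p + 3 * h = t - \<gamma> * L powr p"
    by (simp_all add: h_def field_simps)
  ultimately show "z \<in> lower_part p \<gamma> x t L"
    by (simp add: lower_part_def cube_def mem_Times_iff)
qed

text \<open>The packing half: a small core precedes its own upper part by a time less than
  \<open>2 * l powr p\<close>, and a common point of the two upper parts ties it to the larger
  rectangle. The factor 4 leaves room to spare.\<close>

lemma core_subset_dilation:
  fixes x y :: "real ^ 'n::finite"
  assumes "0 < l" "l \<le> L" "0 \<le> p" "0 \<le> \<gamma>" "\<gamma> < 1"
    and meet: "upper_part p \<gamma> y s l \<inter> upper_part p \<gamma> x t L \<noteq> {}"
  shows "core p \<gamma> y s l \<subseteq> cube x (4 * L) \<times> {t - 4 * L powr p<..<t + 4 * L powr p}"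
proof
  fix z assume z: "z \<in> core p \<gamma> y s l"
  obtain m where m: "m \<in> upper_part p \<gamma> y s l" "m \<in> upper_part p \<gamma> x t L" using meet by blast
  have space: "\<bar>fst z $ i - x $ i\<bar> \<le> 4 * L / 2" for i
  proof -
    have "\<bar>fst z $ i - y $ i\<bar> \<le> l / 3 / 2" "\<bar>fst m $ i - y $ i\<bar> \<le> l / 2" "\<bar>fst m $ i - x $ i\<bar> \<le> L / 2"
      using z m by (simp_all add: cube_def core_def upper_part_def mem_Times_iff)
    then show ?thesis using \<open>l \<le> L\<close> \<open>0 < l\<close> by linarith
  qed
  have bounds: "l powr p \<le> L powr p" "0 \<le> \<gamma> * L powr p" "0 \<le> \<gamma> * l powr p"
      "\<gamma> * l powr p \<le> l powr p" "0 < l powr p"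
    using assms(1-5) by (auto intro: powr_mono2 mult_left_le_one_le)
  \<comment> \<open>Written this way the endpoints are linear in \<open>l powr p\<close> and
    \<open>\<gamma> * l powr p\<close>, and the comparison becomes linear arithmetic.\<close>
  have "s - (1 + \<gamma>) / 2 * l powr p - (1 - \<gamma>) / 6 * l powr p = s - 2 / 3 * l powr p - 1 / 3 * (\<gamma> * l powr p)"
      "s - (1 + \<gamma>) / 2 * l powr p + (1 - \<gamma>) / 6 * l powr p = s - 1 / 3 * l powr p - 2 / 3 * (\<gamma> * l powr p)"
    by (simp_all add: field_simps)
  then have "s - 2 / 3 * l powr p - 1 / 3 * (\<gamma> * l powr p) < snd z"
      "snd z < s - 1 / 3 * l powr p - 2 / 3 * (\<gamma> * l powr p)"
    using z by (simp_all only: core_def mem_Times_iff greaterThanLessThan_iff)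
  moreover have "s + \<gamma> * l powr p < snd m" "snd m < s + l powr p"
      "t + \<gamma> * L powr p < snd m" "snd m < t + L powr p"
    using m by (simp_all add: upper_part_def mem_Times_iff)
  ultimately have "t - 4 * L powr p < snd z \<and> snd z < t + 4 * L powr p"
    using bounds by (intro conjI) linarith+
  then show "z \<in> cube x (4 * L) \<times> {t - 4 * L powr p<..<t + 4 * L powr p}"
    using space by (auto simp: cube_def mem_Times_iff)
qed

lemma emeasure_dilation:
  assumes "0 < L" "\<gamma> < 1"
  shows "emeasure lebesgue (cube (x :: real ^ 'n::finite) (4 * L) \<times> {t - 4 * L powr p<..<t + 4 * L powr p})
    = ennreal (4 ^ CARD('n) * 8 / (1 - \<gamma>)) * emeasure lebesgue (upper_part p \<gamma> x t L)"
proof -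
  have "emeasure lebesgue (cube x (4 * L) \<times> {t - 4 * L powr p<..<t + 4 * L powr p})
    = ennreal ((4 * L) ^ CARD('n) * (8 * L powr p))"
    using assms by (subst emeasure_rectangle) (auto simp: algebra_simps)
  also have "(4 * L) ^ CARD('n) * (8 * L powr p)
    = (4 ^ CARD('n) * 8 / (1 - \<gamma>)) * (L ^ CARD('n) * ((1 - \<gamma>) * L powr p))"
    using assms by (simp add: power_mult_distrib)
  finally show ?thesis using assms by (simp add: emeasure_upper_part flip: ennreal_mult)
qed

text \<open>The power of 3 compares an upper part with its core, the other factor a dilated
  rectangle with the upper part. The \<open>itself\<close> argument carries the dimension.\<close>

definition packing_const :: "'n::finite itself \<Rightarrow> real \<Rightarrow> real" where
  "packing_const _ \<gamma> = 3 ^ Suc CARD('n) * (4 ^ CARD('n) * 8 / (1 - \<gamma>))"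

lemma packing_const_pos: "\<gamma> < 1 \<Longrightarrow> 0 < packing_const TYPE('n::finite) \<gamma>"
  by (simp add: packing_const_def)

text \<open>Vitali selection passes from all cores to the lower parts \<open>D j\<close> of a
  subfamily with disjoint cores. The \<open>w\<close>-mass of each \<open>D j\<close> is then
  charged to the |f|-mass of \<open>U j\<close>, and the packing lemma sums these charges. The
  constant does not depend on the number of rectangles.\<close>

lemma weighted_measure_cores_le:
  fixes f w :: "'n::finite spacetime \<Rightarrow> real" and x :: "'i \<Rightarrow> real ^ 'n" and t L :: "'i \<Rightarrow> real"
  assumes p: "0 \<le> p" and \<gamma>: "0 \<le> \<gamma>" "\<gamma> < 1" and "finite I" and L: "\<And>i. i \<in> I \<Longrightarrow> 0 < L i"
    and avg: "\<And>i. i \<in> I \<Longrightarrow> average_abs f (upper_part p \<gamma> (x i) (t i) (L i)) = ennreal r" and "0 < r"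
    and f [measurable]: "f \<in> borel_measurable lebesgue"
    and w: "weight w" "locally_integrable w"
  shows "ennreal r * weighted_measure w (\<Union>i\<in>I. core p \<gamma> (x i) (t i) (L i))
    \<le> ennreal (4 * packing_const TYPE('n) \<gamma>)
       * (\<integral>\<^sup>+z. ennreal \<bar>f z\<bar> * uncentered_backward_max p \<gamma> w z \<partial>lebesgue)"
proof -
  define U where "U i = upper_part p \<gamma> (x i) (t i) (L i)" for i
  define D where "D i = lower_part p \<gamma> (x i) (t i) (L i)" for i
  define S where "S i = core p \<gamma> (x i) (t i) (L i)" for i
  note defs = U_def D_def S_def
  define N where "N = density lebesgue (\<lambda>z. ennreal \<bar>f z\<bar>)"
  define W where "W = density lebesgue (\<lambda>z. ennreal (w z))"
  have wm [measurable]: "w \<in> borel_measurable lebesgue" and w0: "\<And>z. 0 \<le> w z"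
    using w(1) by (auto simp: weight_def)
  have sets [measurable, simp]: "U i \<in> sets lebesgue" "D i \<in> sets lebesgue" "S i \<in> sets lebesgue" for i
    by (simp_all add: defs)
  have Mw [measurable]: "uncentered_backward_max p \<gamma> w \<in> borel_measurable lebesgue"
    using borel_measurable_uncentered_backward_max w(2) \<gamma>(2) by blast
  have sets_NW [simp]: "sets N = sets lebesgue" "sets W = sets lebesgue" by (simp_all add: N_def W_def)
  have W: "emeasure W A = weighted_measure w A" if "A \<in> sets lebesgue" for A
    unfolding W_def weighted_measure_def using that by (subst emeasure_density) auto
  have U_pos: "emeasure lebesgue (U i) \<noteq> 0" "emeasure lebesgue (U i) \<noteq> \<infinity>" if "i \<in> I" for i
    using L[OF that] \<gamma> by (simp_all add: U_def emeasure_upper_part)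
  \<comment> \<open>The exact value of the average is used in both directions: from above for the
    small \<open>U k\<close>, from below for \<open>U j\<close>. This turns packing of volumes into
    packing for \<open>N\<close>.\<close>
  have NU: "emeasure N (U i) = ennreal r * emeasure lebesgue (U i)" if "i \<in> I" for i
  proof -
    have "emeasure N (U i) = (\<integral>\<^sup>+z\<in>U i. ennreal \<bar>f z\<bar> \<partial>lebesgue)"
      unfolding N_def by (subst emeasure_density) auto
    also have "\<dots> = average_abs f (U i) * emeasure lebesgue (U i)"
      using U_pos[OF that] by (simp add: average_abs_def ennreal_divide_times ennreal_divide_self top.not_eq_extremum)
    finally show ?thesis using avg[OF that] by (simp add: U_def)
  qed
  have "S i \<noteq> {}" if "i \<in> I" for i
    using center_in_interior_core[OF L[OF that] \<gamma>(2)] interior_subset by (fastforce simp: S_def)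
  then obtain J where J: "J \<subseteq> I" "disjoint_family_on S J"
    "\<And>i. i \<in> I \<Longrightarrow> \<exists>j\<in>J. S i \<inter> S j \<noteq> {} \<and> L i \<le> L j"
    using finite_Vitali_selection[OF \<open>finite I\<close>, of S L] by metis
  have [simp]: "finite J" using J(1) \<open>finite I\<close> finite_subset by blast
  have "(\<Union>i\<in>I. S i) \<subseteq> (\<Union>j\<in>J. D j)"
  proof (rule UN_least)
    fix i assume "i \<in> I"
    then obtain j where "j \<in> J" "S i \<inter> S j \<noteq> {}" "L i \<le> L j" using J(3) by blast
    then show "S i \<subseteq> (\<Union>j\<in>J. D j)"
      using core_subset_lower_part[of "L i" "L j" p \<gamma>] L[OF \<open>i \<in> I\<close>] p \<gamma> by (fastforce simp: defs)
  qed
  then have "weighted_measure w (\<Union>i\<in>I. S i) \<le> emeasure W (\<Union>j\<in>J. D j)"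
    using \<open>finite I\<close> by (subst W[symmetric]) (auto intro!: emeasure_mono)
  also have "\<dots> \<le> (\<Sum>j\<in>J. emeasure W (D j))"
    by (intro emeasure_subadditive_finite) auto
  finally have "ennreal r * weighted_measure w (\<Union>i\<in>I. S i) \<le> (\<Sum>j\<in>J. ennreal r * emeasure W (D j))"
    by (simp add: mult_left_mono flip: sum_distrib_left)
  also have "\<dots> = (\<Sum>j\<in>J. average_abs w (D j) * emeasure N (U j))"
  proof (rule sum.cong[OF refl])
    fix j assume "j \<in> J"
    then have j: "j \<in> I" using J(1) by blast
    have D: "emeasure lebesgue (D j) = emeasure lebesgue (U j)"
      using L[OF j] \<gamma> by (simp add: defs emeasure_lower_part)
    \<comment> \<open>Since \<open>D j\<close> and \<open>U j\<close> have equal volume,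
      \<open>r\<close> times the volume of \<open>D j\<close> is the \<open>N\<close>-mass of
      \<open>U j\<close>. This is the step from the past to the future.\<close>
    have "average_abs w (D j) * emeasure N (U j)
        = ennreal r * (average_abs w (D j) * emeasure lebesgue (U j))"
      by (simp add: NU[OF j] ac_simps)
    also have "average_abs w (D j) * emeasure lebesgue (U j) = emeasure W (D j)"
      using U_pos[OF j] w0
      by (simp add: average_abs_def D W weighted_measure_def ennreal_divide_times ennreal_divide_self top.not_eq_extremum)
    finally show "ennreal r * emeasure W (D j) = average_abs w (D j) * emeasure N (U j)" ..
  qed
  also have "\<dots> \<le> ennreal (4 * packing_const TYPE('n) \<gamma>) * (\<integral>\<^sup>+z. uncentered_backward_max p \<gamma> w z \<partial>N)"
  proof (rule sum_le_nn_integral_of_packing[where L = L])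
    show "0 < packing_const TYPE('n) \<gamma>" using \<gamma>(2) by (rule packing_const_pos)
    show "uncentered_backward_max p \<gamma> w \<in> borel_measurable N" by (simp add: N_def)
    fix j assume "j \<in> J"
    then have j: "j \<in> I" using J(1) by blast
    show "U j \<in> sets N" by simp
    show "emeasure N (U j) < \<infinity>"
      using U_pos[OF j] by (simp add: NU[OF j] ennreal_mult_less_top top.not_eq_extremum)
    show "average_abs w (D j) \<le> uncentered_backward_max p \<gamma> w z" if "z \<in> U j" for z
      using average_abs_le_uncentered_backward_max[OF L[OF j]] that by (simp add: defs)
    define K where "K = {k \<in> J. L k \<le> L j \<and> U k \<inter> U j \<noteq> {}}"
    define R where "R = cube (x j) (4 * L j) \<times> {t j - 4 * L j powr p<..<t j + 4 * L j powr p}"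
    have K: "K \<subseteq> J" "finite K" by (auto simp: K_def)
    have "(\<Sum>k\<in>{k \<in> J. L k \<le> L j}. emeasure N (U k \<inter> U j)) = (\<Sum>k\<in>K. emeasure N (U k \<inter> U j))"
      by (intro sum.mono_neutral_right) (auto simp: K_def)
    also have "\<dots> \<le> (\<Sum>k\<in>K. ennreal r * emeasure lebesgue (U k))"
    proof (rule sum_mono)
      fix k assume "k \<in> K"
      then have "k \<in> I" using J(1) K(1) by blast
      have "emeasure N (U k \<inter> U j) \<le> emeasure N (U k)" by (intro emeasure_mono) auto
      then show "emeasure N (U k \<inter> U j) \<le> ennreal r * emeasure lebesgue (U k)" by (simp add: NU[OF \<open>k \<in> I\<close>])
    qed
    also have "\<dots> = (\<Sum>k\<in>K. ennreal r * (ennreal (3 ^ Suc CARD('n)) * emeasure lebesgue (S k)))"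
    proof (rule sum.cong[OF refl])
      fix k assume "k \<in> K"
      then have "0 < L k" using J(1) K(1) L by blast
      then show "ennreal r * emeasure lebesgue (U k) = ennreal r * (ennreal (3 ^ Suc CARD('n)) * emeasure lebesgue (S k))"
        unfolding defs by (subst emeasure_upper_part_eq_core[OF _ \<gamma>(2)]) auto
    qed
    also have "\<dots> = ennreal r * (ennreal (3 ^ Suc CARD('n)) * (\<Sum>k\<in>K. emeasure lebesgue (S k)))"
      by (simp add: sum_distrib_left)
    \<comment> \<open>The upper parts overlap but the cores do not, so the sum becomes the volume of
      one set, which lies in the dilation \<open>R\<close> of the rectangle of
      \<open>j\<close>.\<close>
    also have "(\<Sum>k\<in>K. emeasure lebesgue (S k)) = emeasure lebesgue (\<Union>k\<in>K. S k)"
      using J(2) K by (intro sum_emeasure) (auto intro: disjoint_family_on_mono)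
    also have "\<dots> \<le> emeasure lebesgue R"
    proof (rule emeasure_mono)
      show "(\<Union>k\<in>K. S k) \<subseteq> R"
      proof (rule UN_least)
        fix k assume "k \<in> K"
        then have "0 < L k" "L k \<le> L j" "U k \<inter> U j \<noteq> {}" using J(1) L by (auto simp: K_def)
        then show "S k \<subseteq> R"
          unfolding R_def defs by (intro core_subset_dilation p \<gamma>)
      qed
      show "R \<in> sets lebesgue" by (simp add: R_def)
    qed
    also have "\<dots> = ennreal (4 ^ CARD('n) * 8 / (1 - \<gamma>)) * emeasure lebesgue (U j)"
      unfolding R_def U_def by (rule emeasure_dilation[OF L[OF j] \<gamma>(2)])
    also have "ennreal r * (ennreal (3 ^ Suc CARD('n)) * (ennreal (4 ^ CARD('n) * 8 / (1 - \<gamma>)) * emeasure lebesgue (U j)))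
        = ennreal (packing_const TYPE('n) \<gamma>) * emeasure N (U j)"
    proof -
      have "ennreal (packing_const TYPE('n) \<gamma>) = ennreal (3 ^ Suc CARD('n)) * ennreal (4 ^ CARD('n) * 8 / (1 - \<gamma>))"
        unfolding packing_const_def using \<gamma> by (subst ennreal_mult) auto
      then show ?thesis by (simp only: NU[OF j] ac_simps)
    qed
    finally show "(\<Sum>k\<in>{k \<in> J. L k \<le> L j}. emeasure N (U k \<inter> U j))
        \<le> ennreal (packing_const TYPE('n) \<gamma>) * emeasure N (U j)"
      by (simp add: mult_left_mono)
  qed simp
  also have "(\<integral>\<^sup>+z. uncentered_backward_max p \<gamma> w z \<partial>N)
      = (\<integral>\<^sup>+z. ennreal \<bar>f z\<bar> * uncentered_backward_max p \<gamma> w z \<partial>lebesgue)"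
    unfolding N_def by (rule nn_integral_density) auto
  finally show ?thesis by (simp add: S_def)
qed

text \<open>Intermediate value theorem in the sidelength: some average exceeds \<open>r\<close>,
  while for large \<open>L\<close> the finite total mass of |f| is divided by a volume that makes
  the quotient at most \<open>r\<close>.\<close>

lemma exists_rectangle_average_eq:
  fixes f :: "'n::finite spacetime \<Rightarrow> real"
  assumes f: "integrable lebesgue f" and "1 \<le> p" "\<gamma> < 1" "0 < r"
    and r: "ennreal r < centered_forward_max p \<gamma> f (x, s)"
  shows "\<exists>L>0. average_abs f (upper_part p \<gamma> x (s + (1 + \<gamma>) / 2 * L powr p) L) = ennreal r"
proof -
  define A where "A L = average_abs f (upper_part p \<gamma> x (s + (1 + \<gamma>) / 2 * L powr p) L)" for L
  obtain l where "0 < l" and l: "ennreal r < A l"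
    using r by (auto simp: centered_forward_max_eq less_SUP_iff A_def)
  define K where "K = enn2real (\<integral>\<^sup>+z. ennreal \<bar>f z\<bar> \<partial>lebesgue)"
  have K: "(\<integral>\<^sup>+z. ennreal \<bar>f z\<bar> \<partial>lebesgue) = ennreal K" "0 \<le> K"
    using f by (auto simp: K_def integrable_iff_bounded)
  \<comment> \<open>As \<open>b\<close> is at least 1, the volume \<open>V\<close> is at least
    \<open>b * (1 - \<gamma>)\<close>; the last entry of the maximum then gives
    \<open>K \<le> r * V\<close>.\<close>
  define b where "b = max l (max 1 (K / (r * (1 - \<gamma>))))"
  have "l \<le> b" "1 \<le> b" "K / (r * (1 - \<gamma>)) \<le> b" by (auto simp: b_def)
  define V where "V = b ^ CARD('n) * ((1 - \<gamma>) * b powr p)"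
  have "0 < V" using \<open>1 \<le> b\<close> \<open>\<gamma> < 1\<close> by (auto simp: V_def)
  have "K \<le> r * V"
  proof -
    have "b ^ 1 * ((1 - \<gamma>) * 1) \<le> V"
      unfolding V_def using \<open>1 \<le> b\<close> assms(2,3)
      by (intro mult_mono power_increasing mult_left_mono ge_one_powr_ge_zero) (auto simp: Suc_leI)
    then have "r * (b * (1 - \<gamma>)) \<le> r * V" using \<open>0 < r\<close> by simp
    moreover have "K \<le> r * (b * (1 - \<gamma>))"
      using \<open>K / (r * (1 - \<gamma>)) \<le> b\<close> \<open>0 < r\<close> \<open>\<gamma> < 1\<close> by (simp add: field_simps)
    ultimately show ?thesis by simp
  qed
  have "A b \<le> (\<integral>\<^sup>+z. ennreal \<bar>f z\<bar> \<partial>lebesgue) / ennreal V"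
    unfolding A_def average_abs_def V_def using \<open>1 \<le> b\<close> \<open>\<gamma> < 1\<close>
    by (subst emeasure_upper_part)
       (auto intro!: divide_right_mono_ennreal nn_integral_mono simp: indicator_def)
  also have "\<dots> \<le> ennreal r"
    using K \<open>0 < V\<close> \<open>K \<le> r * V\<close> by (auto intro!: ennreal_leI simp: divide_ennreal pos_divide_le_eq)
  finally have "A b \<le> ennreal r" .
  moreover have "continuous_on {l..b} A"
    unfolding A_def upper_part_def using \<open>0 < l\<close> \<open>\<gamma> < 1\<close>
    by (intro continuous_on_sequentiallyI tendsto_average_abs f tendsto_intros) auto
  ultimately have "\<exists>L\<ge>l. L \<le> b \<and> A L = ennreal r"
    using l \<open>l \<le> b\<close> by (intro IVT2') auto
  then obtain L where "l \<le> L" "A L = ennreal r" by blast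
  then show ?thesis using \<open>0 < l\<close> by (intro exI[of _ L]) (auto simp: A_def)
qed

section \<open>From finite families to superlevel sets\<close>

lemma sets_borel_subset_lebesgue: "sets borel \<subseteq> sets lebesgue"
  by (metis sets_completionI_sets sets_lborel subsetI)

lemma weighted_measure_eq:
  assumes "weight w" "A \<in> sets lebesgue"
  shows "weighted_measure w A = emeasure (density lebesgue (\<lambda>z. ennreal (w z))) A"
  using assms by (subst emeasure_density) (auto simp: weighted_measure_def weight_def)

text \<open>Each point of the superlevel set is the center of a lower part whose rectangle has
  average exactly \<open>r\<close>, hence lies in the interior of the corresponding core. Finite
  subfamilies of this open cover obey a common bound.\<close>

lemma weak_type_integrable:
  fixes f w :: "'n::finite spacetime \<Rightarrow> real"
  assumes p: "1 \<le> p" and \<gamma>: "0 \<le> \<gamma>" "\<gamma> < 1" and r: "0 < r" and f: "integrable lebesgue f"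
    and w: "weight w" "locally_integrable w"
  shows "weighted_measure w {z. ennreal r < centered_forward_max p \<gamma> f z}
    \<le> ennreal (4 * packing_const TYPE('n) \<gamma> / r)
       * (\<integral>\<^sup>+z. ennreal \<bar>f z\<bar> * uncentered_backward_max p \<gamma> w z \<partial>lebesgue)"
proof -
  define W where "W = density lebesgue (\<lambda>z. ennreal (w z))"
  define T where "T = {(x, t, L). 0 < L \<and> average_abs f (upper_part p \<gamma> x t L) = ennreal r}"
  define S where "S = (\<lambda>(x :: real ^ 'n, t, L). core p \<gamma> x t L)"
  define c where "c = ennreal (4 * packing_const TYPE('n) \<gamma> / r)
       * (\<integral>\<^sup>+z. ennreal \<bar>f z\<bar> * uncentered_backward_max p \<gamma> w z \<partial>lebesgue)"
  have C: "0 < packing_const TYPE('n) \<gamma>" using packing_const_pos \<gamma>(2) .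
  have sub: "{z. ennreal r < centered_forward_max p \<gamma> f z} \<subseteq> \<Union>((interior \<circ> S) ` T)"
  proof clarify
    fix x s assume "ennreal r < centered_forward_max p \<gamma> f (x, s)"
    then obtain L where L: "0 < L"
      "average_abs f (upper_part p \<gamma> x (s + (1 + \<gamma>) / 2 * L powr p) L) = ennreal r"
      using exists_rectangle_average_eq[OF f p \<gamma>(2) r] by blast
    have "lower_center p \<gamma> x (s + (1 + \<gamma>) / 2 * L powr p) L = (x, s)"
      by (simp add: lower_center_def midpoint_def field_simps)
    then have "(x, s) \<in> interior (S (x, s + (1 + \<gamma>) / 2 * L powr p, L))"
      using center_in_interior_core[OF L(1) \<gamma>(2)] by (metis S_def case_prod_conv)
    moreover have "(x, s + (1 + \<gamma>) / 2 * L powr p, L) \<in> T" using L by (simp add: T_def)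
    ultimately show "(x, s) \<in> \<Union>((interior \<circ> S) ` T)" by force
  qed
  have "emeasure W (\<Union>((interior \<circ> S) ` T)) \<le> c"
  proof (rule emeasure_Union_open_le)
    show "sets borel \<subseteq> sets W" using sets_borel_subset_lebesgue by (simp add: W_def)
    fix F' assume "finite F'" "F' \<subseteq> (interior \<circ> S) ` T"
    then obtain I where I: "I \<subseteq> T" "finite I" "F' = (interior \<circ> S) ` I"
      using finite_subset_image by metis
    have "emeasure W (\<Union>F') \<le> emeasure W (\<Union>i\<in>I. S i)"
    proof (rule emeasure_mono)
      show "\<Union>F' \<subseteq> (\<Union>i\<in>I. S i)" using I(3) interior_subset by fastforce
      show "(\<Union>i\<in>I. S i) \<in> sets W" using I(2) by (auto simp: W_def S_def)
    qed
    also have "\<dots> = weighted_measure w (\<Union>i\<in>I. S i)"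
      unfolding W_def using I(2) by (intro weighted_measure_eq[symmetric] w) (auto simp: S_def)
    also have "\<dots> = ennreal (1 / r) * (ennreal r * weighted_measure w (\<Union>i\<in>I. S i))"
      using r by (simp flip: mult.assoc ennreal_mult)
    also have "ennreal r * weighted_measure w (\<Union>i\<in>I. S i) \<le> ennreal (4 * packing_const TYPE('n) \<gamma>)
       * (\<integral>\<^sup>+z. ennreal \<bar>f z\<bar> * uncentered_backward_max p \<gamma> w z \<partial>lebesgue)"
      unfolding S_def case_prod_beta
      by (rule weighted_measure_cores_le) (use p \<gamma> r f w I T_def in auto)
    also have "ennreal (1 / r) * (ennreal (4 * packing_const TYPE('n) \<gamma>)
       * (\<integral>\<^sup>+z. ennreal \<bar>f z\<bar> * uncentered_backward_max p \<gamma> w z \<partial>lebesgue)) = c"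
      using r C by (simp add: c_def flip: mult.assoc ennreal_mult)
    finally show "emeasure W (\<Union>F') \<le> c" by (simp add: mult_left_mono)
  qed auto
  moreover have "\<Union>((interior \<circ> S) ` T) \<in> sets lebesgue"
    by (rule subsetD[OF sets_borel_subset_lebesgue], rule borel_open) auto
  then have "weighted_measure w (\<Union>((interior \<circ> S) ` T)) = emeasure W (\<Union>((interior \<circ> S) ` T))"
    unfolding W_def by (rule weighted_measure_eq[OF w(1)])
  moreover have "weighted_measure w {z. ennreal r < centered_forward_max p \<gamma> f z}
      \<le> weighted_measure w (\<Union>((interior \<circ> S) ` T))"
    unfolding weighted_measure_def using sub
    by (intro nn_integral_mono mult_left_mono) (auto simp: indicator_def)
  ultimately show ?thesis by (simp add: c_def)
qed

text \<open>Because the inequality is strict, the superlevel sets of the truncations increase to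
  that of \<open>f\<close>, and the bound is uniform in \<open>k\<close>.\<close>

lemma weak_type:
  fixes f w :: "'n::finite spacetime \<Rightarrow> real"
  assumes p: "1 \<le> p" and \<gamma>: "0 \<le> \<gamma>" "\<gamma> < 1" and r: "0 < r" and f: "locally_integrable f"
    and w: "weight w" "locally_integrable w"
  shows "weighted_measure w {z. ennreal r < centered_forward_max p \<gamma> f z}
    \<le> ennreal (4 * packing_const TYPE('n) \<gamma> / r)
       * (\<integral>\<^sup>+z. ennreal \<bar>f z\<bar> * uncentered_backward_max p \<gamma> w z \<partial>lebesgue)"
proof -
  define E where "E k = {z. ennreal r < centered_forward_max p \<gamma> (truncation k f) z}" for k
  have E: "E k \<in> sets lebesgue" for k
    unfolding E_def using open_superlevel_integrable_centered_forward_max[OF integrable_truncation[OF f] \<gamma>(2)]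
    by (intro subsetD[OF sets_borel_subset_lebesgue] borel_open)
  have "centered_forward_max p \<gamma> (truncation k f) z \<le> centered_forward_max p \<gamma> (truncation l f) z"
    if "k \<le> l" for k l z
    using that by (cases z) (auto simp: centered_forward_max_eq truncation_def indicator_def
        intro!: SUP_mono' average_abs_mono)
  then have "incseq E" by (auto simp: incseq_def E_def intro: less_le_trans)
  have "{z. ennreal r < centered_forward_max p \<gamma> f z} = (\<Union>k. E k)"
    by (auto simp: E_def centered_forward_max_truncation[OF f] less_SUP_iff)
  then have "weighted_measure w {z. ennreal r < centered_forward_max p \<gamma> f z} = (SUP k. weighted_measure w (E k))"
    using E \<open>incseq E\<close> by (simp add: weighted_measure_eq[OF w(1)] SUP_emeasure_incseq image_subset_iff)
  also have "\<dots> \<le> ennreal (4 * packing_const TYPE('n) \<gamma> / r)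
       * (\<integral>\<^sup>+z. ennreal \<bar>f z\<bar> * uncentered_backward_max p \<gamma> w z \<partial>lebesgue)"
  proof (rule SUP_least)
    fix k
    have "weighted_measure w (E k) \<le> ennreal (4 * packing_const TYPE('n) \<gamma> / r)
       * (\<integral>\<^sup>+z. ennreal \<bar>truncation k f z\<bar> * uncentered_backward_max p \<gamma> w z \<partial>lebesgue)"
      unfolding E_def by (intro weak_type_integrable assms integrable_truncation)
    also have "\<dots> \<le> ennreal (4 * packing_const TYPE('n) \<gamma> / r)
       * (\<integral>\<^sup>+z. ennreal \<bar>f z\<bar> * uncentered_backward_max p \<gamma> w z \<partial>lebesgue)"
      by (intro mult_left_mono nn_integral_mono mult_right_mono ennreal_leI)
         (auto simp: truncation_def indicator_def)
    finally show "weighted_measure w (E k) \<le> \<dots>" .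
  qed
  finally show ?thesis .
qed

text \<open>The discarded part of \<open>f\<close> is bounded by \<open>c\<close>, and so are all
  its averages.\<close>

lemma centered_forward_max_le_large_part:
  fixes f :: "'n::finite spacetime \<Rightarrow> real"
  assumes f: "locally_integrable f" and "\<gamma> < 1" "0 \<le> c"
  shows "centered_forward_max p \<gamma> f z
    \<le> centered_forward_max p \<gamma> (\<lambda>z. if c < \<bar>f z\<bar> then f z else 0) z + ennreal c"
proof -
  define g where "g = (\<lambda>z. if c < \<bar>f z\<bar> then f z else 0)"
  have [measurable]: "f \<in> borel_measurable lebesgue" using f by (rule locally_integrable_measurable)
  have [measurable]: "g \<in> borel_measurable lebesgue" unfolding g_def by measurable
  have avg: "average_abs f U \<le> average_abs g U + ennreal c"
    if U [measurable]: "U \<in> sets lebesgue" and U0: "emeasure lebesgue U \<noteq> 0" "emeasure lebesgue U < top" for U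
  proof -
    have "(\<integral>\<^sup>+z\<in>U. ennreal \<bar>f z\<bar> \<partial>lebesgue)
        \<le> (\<integral>\<^sup>+z. ennreal \<bar>g z\<bar> * indicator U z + ennreal c * indicator U z \<partial>lebesgue)"
      by (intro nn_integral_mono) (auto simp: g_def indicator_def intro: ennreal_leI)
    also have "\<dots> = (\<integral>\<^sup>+z\<in>U. ennreal \<bar>g z\<bar> \<partial>lebesgue) + ennreal c * emeasure lebesgue U"
      by (subst nn_integral_add) (auto simp: nn_integral_cmult_indicator)
    finally have "average_abs f U
        \<le> ((\<integral>\<^sup>+z\<in>U. ennreal \<bar>g z\<bar> \<partial>lebesgue) + ennreal c * emeasure lebesgue U) / emeasure lebesgue U"
      unfolding average_abs_def by (rule divide_right_mono_ennreal)
    also have "\<dots> = average_abs g U + ennreal c"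
      using U0 by (simp add: average_abs_def add_divide_distrib_ennreal ennreal_mult_divide_eq top.not_eq_extremum)
    finally show ?thesis .
  qed
  have le: "average_abs f (upper_part p \<gamma> x (s + (1 + \<gamma>) / 2 * L powr p) L)
      \<le> centered_forward_max p \<gamma> g (x, s) + ennreal c" if "0 < L" for x s L
  proof -
    have "average_abs f (upper_part p \<gamma> x (s + (1 + \<gamma>) / 2 * L powr p) L)
      \<le> average_abs g (upper_part p \<gamma> x (s + (1 + \<gamma>) / 2 * L powr p) L) + ennreal c"
      using that \<open>\<gamma> < 1\<close> by (intro avg) (auto simp: emeasure_upper_part)
    also have "\<dots> \<le> centered_forward_max p \<gamma> g (x, s) + ennreal c"
      unfolding centered_forward_max_eq using that by (intro add_right_mono SUP_upper) auto
    finally show ?thesis .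
  qed
  show ?thesis
    unfolding g_def[symmetric] centered_forward_max_eq[of p \<gamma> f "fst z" "snd z", simplified prod.collapse]
    using le[of _ "fst z" "snd z"] by (intro SUP_least) simp
qed

text \<open>Where the maximal function of \<open>f\<close> exceeds \<open>2 * c\<close>, that of the
  part of \<open>f\<close> above height \<open>c\<close> exceeds \<open>c\<close>; the weak type
  bound is applied to this part only.\<close>

lemma weak_type_large_part:
  fixes f w :: "'n::finite spacetime \<Rightarrow> real"
  assumes p: "1 \<le> p" and \<gamma>: "0 \<le> \<gamma>" "\<gamma> < 1" and c: "0 < c" and f: "locally_integrable f"
    and w: "weight w" "locally_integrable w"
  shows "weighted_measure w {z. ennreal (2 * c) < centered_forward_max p \<gamma> f z}
    \<le> ennreal (4 * packing_const TYPE('n) \<gamma> / c)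
       * (\<integral>\<^sup>+z. ennreal \<bar>f z\<bar> * indicator {z. c < \<bar>f z\<bar>} z * uncentered_backward_max p \<gamma> w z \<partial>lebesgue)"
proof -
  define g where "g = (\<lambda>z. if c < \<bar>f z\<bar> then f z else 0)"
  have [measurable]: "f \<in> borel_measurable lebesgue" using f by (rule locally_integrable_measurable)
  have g: "locally_integrable g"
    by (rule locally_integrable_bound[OF f]) (auto simp: g_def)
  have "ennreal c < centered_forward_max p \<gamma> g z" if "ennreal (2 * c) < centered_forward_max p \<gamma> f z" for z
  proof (rule ccontr)
    assume "\<not> ennreal c < centered_forward_max p \<gamma> g z"
    then have "centered_forward_max p \<gamma> g z + ennreal c \<le> ennreal c + ennreal c"
      by (intro add_right_mono) simp
    also have "\<dots> = ennreal (2 * c)" using c by (simp flip: ennreal_plus)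
    finally have "centered_forward_max p \<gamma> f z \<le> ennreal (2 * c)"
      using centered_forward_max_le_large_part[OF f \<gamma>(2) less_imp_le[OF c], of p z]
      unfolding g_def by (rule order_trans[rotated])
    then show False using that by (simp add: leD)
  qed
  then have "weighted_measure w {z. ennreal (2 * c) < centered_forward_max p \<gamma> f z}
      \<le> weighted_measure w {z. ennreal c < centered_forward_max p \<gamma> g z}"
    unfolding weighted_measure_def by (intro nn_integral_mono mult_left_mono) (auto simp: indicator_def)
  also have "\<dots> \<le> ennreal (4 * packing_const TYPE('n) \<gamma> / c)
       * (\<integral>\<^sup>+z. ennreal \<bar>g z\<bar> * uncentered_backward_max p \<gamma> w z \<partial>lebesgue)"
    by (intro weak_type p \<gamma> c g w)
  also have "(\<lambda>z. ennreal \<bar>g z\<bar>) = (\<lambda>z. ennreal \<bar>f z\<bar> * indicator {z. c < \<bar>f z\<bar>} z)"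
    by (auto simp: g_def indicator_def)
  finally show ?thesis by (simp add: fun_eq_iff cong: nn_integral_cong)
qed

subsection \<open>Strong type estimate\<close>

text \<open>A geometric series with ratio \<open>2 powr - s\<close>, summed downwards from the
  largest admissible exponent. Here and below \<open>int_decode\<close> makes a sum over all
  integers a series over the naturals.\<close>

lemma sum_dyadic_powr_le:
  fixes s b :: real
  assumes "0 < s" "0 < b"
  shows "(\<Sum>i. ennreal (2 powr (real_of_int (int_decode i) * s))
             * indicator {k. 2 powr real_of_int k < b} (int_decode i))
    \<le> ennreal (b powr s / (1 - 2 powr - s))"
proof (rule suminf_le_const[OF summableI])
  fix m
  define K where "K = {k \<in> int_decode ` {..<m}. 2 powr real_of_int k < b}"
  \<comment> \<open>No admissible exponent exceeds \<open>k0\<close>, so \<open>j k\<close> is the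
    true distance from \<open>k0\<close> to \<open>k\<close> and is injective on
    \<open>K\<close>.\<close>
  define k0 where "k0 = \<lfloor>log 2 b\<rfloor>"
  define j where "j k = nat (k0 - k)" for k
  have "finite K" by (simp add: K_def)
  have k0: "k \<le> k0" if "k \<in> K" for k
  proof -
    have "real_of_int k < log 2 b" using that \<open>0 < b\<close> by (simp add: K_def less_log_iff)
    then show ?thesis unfolding k0_def by linarith
  qed
  have rho: "(2::real) powr - s < 1" using powr_less_mono[of "- s" 0 2] \<open>0 < s\<close> by simp
  have "(\<Sum>i<m. ennreal (2 powr (real_of_int (int_decode i) * s))
             * indicator {k. 2 powr real_of_int k < b} (int_decode i))
      = (\<Sum>k\<in>int_decode ` {..<m}. ennreal (2 powr (real_of_int k * s)) * indicator {k. 2 powr real_of_int k < b} k)"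
    by (subst sum.reindex) (auto intro: inj_on_subset[OF inj_int_decode])
  also have "\<dots> = (\<Sum>k\<in>K. ennreal (2 powr (real_of_int k * s)))"
    by (rule sum.mono_neutral_cong_right) (auto simp: K_def)
  also have "\<dots> = ennreal (\<Sum>k\<in>K. 2 powr (real_of_int k * s))"
    by (simp add: sum_ennreal)
  also have "\<dots> \<le> ennreal (b powr s / (1 - 2 powr - s))"
  proof (rule ennreal_leI)
    have "(\<Sum>k\<in>K. 2 powr (real_of_int k * s)) = (\<Sum>k\<in>K. 2 powr (real_of_int k0 * s) * (2 powr - s) ^ j k)"
    proof (rule sum.cong[OF refl])
      fix k assume "k \<in> K"
      then have k: "real_of_int k = real_of_int k0 - real (j k)" using k0[of k] by (simp add: j_def)
      show "2 powr (real_of_int k * s) = 2 powr (real_of_int k0 * s) * (2 powr - s) ^ j k"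
        unfolding k by (simp add: powr_powr algebra_simps flip: powr_realpow powr_add)
    qed
    also have "\<dots> = 2 powr (real_of_int k0 * s) * (\<Sum>i\<in>j ` K. (2 powr - s) ^ i)"
    proof -
      have "inj_on j K"
      proof (rule inj_onI)
        fix x y assume "x \<in> K" "y \<in> K" "j x = j y"
        then show "x = y" using k0[of x] k0[of y] by (simp add: j_def)
      qed
      then show ?thesis by (simp add: sum.reindex sum_distrib_left)
    qed
    also have "\<dots> \<le> 2 powr (real_of_int k0 * s) * (1 / (1 - 2 powr - s))"
    proof (rule mult_left_mono)
      have "(\<Sum>i\<in>j ` K. (2 powr - s) ^ i) \<le> (\<Sum>i. (2 powr - s) ^ i)"
        using rho \<open>finite K\<close> by (intro sum_le_suminf summable_geometric) auto
      also have "\<dots> = 1 / (1 - 2 powr - s)" using rho by (intro suminf_geometric) auto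
      finally show "(\<Sum>i\<in>j ` K. (2 powr - s) ^ i) \<le> 1 / (1 - 2 powr - s)" .
    qed simp
    also have "2 powr (real_of_int k0 * s) \<le> b powr s"
    proof -
      have "2 powr real_of_int k0 \<le> b"
        using \<open>0 < b\<close> by (simp add: k0_def powr_le_iff)
      then show ?thesis using \<open>0 < s\<close> by (subst powr_powr[symmetric]) (auto intro: powr_mono2)
    qed
    finally show "(\<Sum>k\<in>K. 2 powr (real_of_int k * s)) \<le> b powr s / (1 - 2 powr - s)"
      using rho by (simp add: divide_right_mono mult_right_mono)
  qed
  finally show "(\<Sum>i<m. ennreal (2 powr (real_of_int (int_decode i) * s))
             * indicator {k. 2 powr real_of_int k < b} (int_decode i)) \<le> \<dots>" .
qed

text \<open>For finite positive \<open>a\<close> a single term is large enough; for infinite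
  \<open>a\<close> all terms are present and they are unbounded. The factor 2 in the threshold
  matches the level \<open>2 * c\<close> of \<open>weak_type_large_part\<close>.\<close>

lemma ennreal_powr_le_dyadic_sum:
  assumes "0 < q"
  shows "ennreal_powr a q \<le> (\<Sum>i. ennreal (2 powr ((real_of_int (int_decode i) + 2) * q))
             * indicator {a. ennreal (2 * 2 powr real_of_int (int_decode i)) < a} a)"
    (is "_ \<le> (\<Sum>i. ?t i)")
proof -
  have le: "ennreal (2 powr ((real_of_int k + 2) * q)) \<le> (\<Sum>i. ?t i)"
    if "ennreal (2 * 2 powr real_of_int k) < a" for k
  proof -
    have "?t (int_encode k) \<le> (\<Sum>i. ?t i)"
      using sum_le_suminf[of ?t "{int_encode k}"] by (simp add: summableI)
    then show ?thesis using that by simp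
  qed
  show ?thesis
  proof (cases a)
    case (real r)
    show ?thesis
    proof (cases "r = 0")
      case False
      then have "0 < r" using real by simp
      \<comment> \<open>The integer with \<open>2 powr (k + 1) < r \<le> 2 powr (k + 2)\<close>: the
        left bound switches the term on, the right one makes it at least
        \<open>r powr q\<close>.\<close>
      define k where "k = \<lceil>log 2 r\<rceil> - 2"
      have "log 2 r \<le> real_of_int k + 2" "real_of_int k + 1 < log 2 r" unfolding k_def by linarith+
      then have "r \<le> 2 powr (real_of_int k + 2)" "2 powr (real_of_int k + 1) < r"
        using \<open>0 < r\<close> by (simp_all add: log_le_iff less_log_iff)
      then have "r powr q \<le> 2 powr ((real_of_int k + 2) * q)" "2 * 2 powr real_of_int k < r"
        using \<open>0 < r\<close> \<open>0 < q\<close> powr_mono2[of q r "2 powr (real_of_int k + 2)"]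
        by (simp add: powr_powr, simp add: powr_add)
      then show ?thesis
        using le[of k] real \<open>0 < r\<close> order_trans[OF ennreal_leI]
        by (fastforce simp: ennreal_powr_def ennreal_less_iff)
    qed (use real in \<open>simp add: ennreal_powr_def\<close>)
  next
    case top
    have "(\<Sum>i. ?t i) = \<infinity>"
    proof (rule ccontr)
      assume "(\<Sum>i. ?t i) \<noteq> \<infinity>"
      then obtain s where s: "(\<Sum>i. ?t i) = ennreal s" "0 \<le> s" by (cases "\<Sum>i. ?t i") auto
      define k where "k = \<lceil>log 2 (s + 1) / q\<rceil>"
      have "log 2 (s + 1) / q \<le> real_of_int k + 2" unfolding k_def by linarith
      then have "log 2 (s + 1) \<le> (real_of_int k + 2) * q" using \<open>0 < q\<close> by (simp add: pos_divide_le_eq)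
      then have "s + 1 \<le> 2 powr ((real_of_int k + 2) * q)" using s(2) by (simp add: log_le_iff)
      then have "ennreal s < ennreal (2 powr ((real_of_int k + 2) * q))"
        using s(2) by (simp add: ennreal_less_iff)
      moreover have "ennreal (2 powr ((real_of_int k + 2) * q)) \<le> (\<Sum>i. ?t i)"
        by (rule le) (simp add: top)
      ultimately show False unfolding s(1) by (meson leD)
    qed
    then show ?thesis by (simp add: top_greatest)
  qed
qed

text \<open>The dyadic sum bounds the left side by \<open>w\<close>-masses of superlevel sets; the
  weak type bound at height \<open>c i\<close> applies to each. Exchanging sum and integral leaves,
  at each point, a geometric series over the heights below |f|.\<close>

lemma strong_type:
  fixes f w :: "'n::finite spacetime \<Rightarrow> real"
  assumes p: "1 \<le> p" and \<gamma>: "0 \<le> \<gamma>" "\<gamma> < 1" and q: "1 < q" and f: "locally_integrable f"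
    and w: "weight w" "locally_integrable w"
  shows "(\<integral>\<^sup>+z. ennreal_powr (centered_forward_max p \<gamma> f z) q * ennreal (w z) \<partial>lebesgue)
    \<le> ennreal (4 * packing_const TYPE('n) \<gamma> * 2 powr (2 * q) / (1 - 2 powr (1 - q)))
       * (\<integral>\<^sup>+z. ennreal (\<bar>f z\<bar> powr q) * uncentered_backward_max p \<gamma> w z \<partial>lebesgue)"
proof -
  define M where "M = centered_forward_max p \<gamma> f"
  define N where "N = uncentered_backward_max p \<gamma> w"
  define C where "C = 4 * packing_const TYPE('n) \<gamma> * 2 powr (2 * q)"
  define c :: "nat \<Rightarrow> real" where "c i = 2 powr real_of_int (int_decode i)" for i
  define h where "h i z = ennreal (2 powr (real_of_int (int_decode i) * (q - 1)))
      * indicator {k. 2 powr real_of_int k < \<bar>f z\<bar>} (int_decode i)" for i z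
  have [measurable]: "w \<in> borel_measurable lebesgue" using w(1) by (simp add: weight_def)
  have [measurable]: "f \<in> borel_measurable lebesgue" using f by (rule locally_integrable_measurable)
  have [measurable]: "N \<in> borel_measurable lebesgue"
    unfolding N_def using borel_measurable_uncentered_backward_max w(2) \<gamma>(2) by blast
  have E [measurable]: "{z. ennreal (2 * c i) < M z} \<in> sets lebesgue" for i
    unfolding M_def by (intro subsetD[OF sets_borel_subset_lebesgue] borel_open
        open_superlevel_centered_forward_max f \<gamma>)
  have h_eq: "h i = (\<lambda>z. ennreal (2 powr (real_of_int (int_decode i) * (q - 1)))
      * indicator {z. c i < \<bar>f z\<bar>} z)" for i
    by (auto simp: h_def c_def indicator_def)
  have [measurable]: "h i \<in> borel_measurable lebesgue" for i
    unfolding h_eq by measurable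
  have pos: "0 < 1 - (2::real) powr (1 - q)" using powr_less_mono[of "1 - q" 0 2] q by simp
  have C: "0 < C" unfolding C_def using packing_const_pos[OF \<gamma>(2), where 'n = 'n] by simp
  have "(\<integral>\<^sup>+z. ennreal_powr (M z) q * ennreal (w z) \<partial>lebesgue)
    \<le> (\<integral>\<^sup>+z. (\<Sum>i. ennreal (2 powr ((real_of_int (int_decode i) + 2) * q))
         * (ennreal (w z) * indicator {z. ennreal (2 * c i) < M z} z)) \<partial>lebesgue)"
  proof (rule nn_integral_mono)
    fix z
    have "ennreal_powr (M z) q * ennreal (w z)
      \<le> (\<Sum>i. ennreal (2 powr ((real_of_int (int_decode i) + 2) * q))
           * indicator {a. ennreal (2 * c i) < a} (M z)) * ennreal (w z)"
      unfolding c_def using q by (intro mult_right_mono ennreal_powr_le_dyadic_sum) auto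
    also have "\<dots> = (\<Sum>i. ennreal (2 powr ((real_of_int (int_decode i) + 2) * q))
         * (ennreal (w z) * indicator {z. ennreal (2 * c i) < M z} z))"
      by (simp add: indicator_def ac_simps flip: ennreal_suminf_multc)
    finally show "ennreal_powr (M z) q * ennreal (w z) \<le> \<dots>" .
  qed
  also have "\<dots> = (\<Sum>i. ennreal (2 powr ((real_of_int (int_decode i) + 2) * q))
      * weighted_measure w {z. ennreal (2 * c i) < M z})"
    unfolding weighted_measure_def by (simp add: nn_integral_suminf nn_integral_cmult)
  also have "\<dots> \<le> (\<Sum>i. ennreal C * (\<integral>\<^sup>+z. h i z * (ennreal \<bar>f z\<bar> * N z) \<partial>lebesgue))"
  proof (rule suminf_le[OF _ summableI summableI])
    fix i
    define k where "k = real_of_int (int_decode i)"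
    define J where "J = (\<integral>\<^sup>+z. ennreal \<bar>f z\<bar> * indicator {z. c i < \<bar>f z\<bar>} z * N z \<partial>lebesgue)"
    have "weighted_measure w {z. ennreal (2 * c i) < M z} \<le> ennreal (4 * packing_const TYPE('n) \<gamma> / c i) * J"
      unfolding M_def N_def J_def by (intro weak_type_large_part p \<gamma> f w) (simp add: c_def)
    then have "ennreal (2 powr ((k + 2) * q)) * weighted_measure w {z. ennreal (2 * c i) < M z}
        \<le> ennreal (2 powr ((k + 2) * q)) * (ennreal (4 * packing_const TYPE('n) \<gamma> / c i) * J)"
      by (rule mult_left_mono) simp
    also have "\<dots> = ennreal (2 powr ((k + 2) * q) * (4 * packing_const TYPE('n) \<gamma> / c i)) * J"
      using packing_const_pos[OF \<gamma>(2), where 'n = 'n]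
      by (subst ennreal_mult) (auto simp: c_def mult.assoc)
    \<comment> \<open>The division by \<open>c i\<close>, which is \<open>2 powr k\<close>, lowers
      the exponent from \<open>k * q\<close> to \<open>k * (q - 1)\<close>; the shift by 2
      contributes \<open>2 powr (2 * q)\<close>.\<close>
    also have "2 powr ((k + 2) * q) * (4 * packing_const TYPE('n) \<gamma> / c i) = C * 2 powr (k * (q - 1))"
      by (simp add: C_def c_def k_def algebra_simps powr_add powr_diff)
    also have "ennreal (C * 2 powr (k * (q - 1))) * J = ennreal C * (ennreal (2 powr (k * (q - 1))) * J)"
      using C by (simp add: ennreal_mult mult.assoc)
    also have "ennreal (2 powr (k * (q - 1))) * J = (\<integral>\<^sup>+z. h i z * (ennreal \<bar>f z\<bar> * N z) \<partial>lebesgue)"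
      unfolding J_def h_eq k_def by (simp add: ac_simps flip: nn_integral_cmult)
    finally show "ennreal (2 powr ((real_of_int (int_decode i) + 2) * q)) * weighted_measure w {z. ennreal (2 * c i) < M z}
        \<le> ennreal C * (\<integral>\<^sup>+z. h i z * (ennreal \<bar>f z\<bar> * N z) \<partial>lebesgue)"
      by (simp add: k_def)
  qed
  also have "\<dots> = ennreal C * (\<integral>\<^sup>+z. (\<Sum>i. h i z * (ennreal \<bar>f z\<bar> * N z)) \<partial>lebesgue)"
    by (subst nn_integral_suminf) auto
  also have "\<dots> \<le> ennreal C * (\<integral>\<^sup>+z. ennreal (1 / (1 - 2 powr (1 - q))) * (ennreal (\<bar>f z\<bar> powr q) * N z) \<partial>lebesgue)"
  proof (intro mult_left_mono nn_integral_mono)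
    fix z
    show "(\<Sum>i. h i z * (ennreal \<bar>f z\<bar> * N z))
        \<le> ennreal (1 / (1 - 2 powr (1 - q))) * (ennreal (\<bar>f z\<bar> powr q) * N z)"
    proof (cases "f z = 0")
      case False
      have "(\<Sum>i. h i z * (ennreal \<bar>f z\<bar> * N z)) = (\<Sum>i. h i z) * (ennreal \<bar>f z\<bar> * N z)" by simp
      \<comment> \<open>The series converges because \<open>q - 1\<close> is positive. The missing
        power of |f| comes from the factor |f| of the weak type integral.\<close>
      also have "(\<Sum>i. h i z) \<le> ennreal (\<bar>f z\<bar> powr (q - 1) / (1 - 2 powr - (q - 1)))"
        unfolding h_def using q False by (intro sum_dyadic_powr_le) auto
      also have "ennreal (\<bar>f z\<bar> powr (q - 1) / (1 - 2 powr - (q - 1))) * (ennreal \<bar>f z\<bar> * N z)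
          = ennreal (\<bar>f z\<bar> powr (q - 1) / (1 - 2 powr (1 - q)) * \<bar>f z\<bar>) * N z"
        using pos by (subst ennreal_mult) (auto simp: mult.assoc)
      also have "\<bar>f z\<bar> powr (q - 1) / (1 - 2 powr (1 - q)) * \<bar>f z\<bar> = 1 / (1 - 2 powr (1 - q)) * \<bar>f z\<bar> powr q"
        using False by (simp add: powr_diff)
      also have "ennreal \<dots> * N z = ennreal (1 / (1 - 2 powr (1 - q))) * (ennreal (\<bar>f z\<bar> powr q) * N z)"
        using pos by (subst ennreal_mult) (auto simp: mult.assoc)
      finally show ?thesis by (simp add: mult_right_mono)
    qed simp
  qed simp
  also have "\<dots> = ennreal (C / (1 - 2 powr (1 - q)))
      * (\<integral>\<^sup>+z. ennreal (\<bar>f z\<bar> powr q) * N z \<partial>lebesgue)"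
  proof -
    have "ennreal (C / (1 - 2 powr (1 - q))) = ennreal C * ennreal (1 / (1 - 2 powr (1 - q)))"
      using C pos by (simp flip: ennreal_mult)
    then show ?thesis by (subst nn_integral_cmult) (auto simp: mult.assoc)
  qed
  finally show ?thesis by (simp add: M_def N_def C_def)
qed

theorem theorem1p9:
  fixes p \<gamma> :: real
  assumes "1 \<le> p" and "0 \<le> \<gamma>" and "\<gamma> < 1"
  shows "(\<exists>C1::real. 0 < C1 \<and>
           (\<forall>w :: 'n::finite spacetime \<Rightarrow> real. weight w \<longrightarrow> locally_integrable w \<longrightarrow>
             (\<forall>(r::real) f. 0 < r \<longrightarrow> locally_integrable f \<longrightarrow>
               weighted_measure w {z. ennreal r < centered_forward_max p \<gamma> f z}
               \<le> ennreal (C1 / r) *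
                 (\<integral>\<^sup>+z. ennreal \<bar>f z\<bar> * uncentered_backward_max p \<gamma> w z \<partial>lebesgue))))
       \<and> (\<forall>q::real. 1 < q \<longrightarrow> (\<exists>C2::real. 0 < C2 \<and>
           (\<forall>w :: 'n spacetime \<Rightarrow> real. weight w \<longrightarrow> locally_integrable w \<longrightarrow>
             (\<forall>f. locally_integrable f \<longrightarrow>
               (\<integral>\<^sup>+z. ennreal_powr (centered_forward_max p \<gamma> f z) q * ennreal (w z) \<partial>lebesgue)
               \<le> ennreal C2 *
                 (\<integral>\<^sup>+z. ennreal (\<bar>f z\<bar> powr q) * uncentered_backward_max p \<gamma> w z \<partial>lebesgue)))))"
proof (intro conjI allI impI)
  have C: "0 < packing_const TYPE('n) \<gamma>" using packing_const_pos assms(3) .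
  show "\<exists>C1::real. 0 < C1 \<and>
           (\<forall>w :: 'n spacetime \<Rightarrow> real. weight w \<longrightarrow> locally_integrable w \<longrightarrow>
             (\<forall>(r::real) f. 0 < r \<longrightarrow> locally_integrable f \<longrightarrow>
               weighted_measure w {z. ennreal r < centered_forward_max p \<gamma> f z}
               \<le> ennreal (C1 / r) *
                 (\<integral>\<^sup>+z. ennreal \<bar>f z\<bar> * uncentered_backward_max p \<gamma> w z \<partial>lebesgue)))"
    using C by (intro exI[of _ "4 * packing_const TYPE('n) \<gamma>"] conjI allI impI weak_type assms) simp
  fix q :: real assume q: "1 < q"
  then have "0 < 1 - (2::real) powr (1 - q)" using powr_less_mono[of "1 - q" 0 2] by simp
  then show "\<exists>C2::real. 0 < C2 \<and>
           (\<forall>w :: 'n spacetime \<Rightarrow> real. weight w \<longrightarrow> locally_integrable w \<longrightarrow>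
             (\<forall>f. locally_integrable f \<longrightarrow>
               (\<integral>\<^sup>+z. ennreal_powr (centered_forward_max p \<gamma> f z) q * ennreal (w z) \<partial>lebesgue)
               \<le> ennreal C2 *
                 (\<integral>\<^sup>+z. ennreal (\<bar>f z\<bar> powr q) * uncentered_backward_max p \<gamma> w z \<partial>lebesgue)))"
    using C
    by (intro exI[of _ "4 * packing_const TYPE('n) \<gamma> * 2 powr (2 * q) / (1 - 2 powr (1 - q))"]
        conjI allI impI strong_type assms q) simp
qed

end
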